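(* Let $(K,k)$ be a pair of fields of characteristic $3$ with $K^3\le k\le K$, and let $U=U(k,K)$ be the subgroup of $G_2(k,K)$ generated by the positive root groups. Then $U$ (as a group) is definable in $(K,k)$, and $(K,k)$ is definable in $U$.
   Context: $G_2(k,K)$ is the subgroup of the Chevalley group $G_2(K)$ generated by the root subgroups $U_\alpha(K)$ for $\alpha$ short and $U_\alpha(k)$ for $\alpha$ long. $(K,k)$ denotes the field $K$ with a unary predicate for $k$. Concretely, $U$ is generated by root groups $U_1,\dots,U_6$, $U_i=\{x_i(c)\}$, with $c$ ranging over $K$ for $i$ odd and over $k$ for $i$ even, subject to the relations $[x_1(a),x_5(b)]=x_3(-ab)$, $[x_2(t),x_6(u)]=x_4(tu)$, $[x_1(a),x_6(t)]=x_2(-ta^3)x_3(ta^2)x_4(t^2a^3)x_5(-ta)$ ($a,b\in K$, $t,u\in k$), all other pairs $U_i,U_j$ commuting. "Definable in" is meant in the sense of model-theoretic interpretability (parameters allowed). *)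

theory Defs
  imports "HOL-Algebra.Group"
begin

section \<open>First-order structures, definable sets and interpretations\<close>

text \<open>A signature assigns an arity to each of its symbols; symbols of the carrier types that are
  mapped to \<^const>\<open>None\<close> do not belong to the language.\<close>

record ('f, 'r) signature =
  fun_ar :: "'f \<Rightarrow> nat option"
  rel_ar :: "'r \<Rightarrow> nat option"

datatype 'f trm = Var nat | Fn 'f "'f trm list"

datatype ('f, 'r) form =
    Equal "'f trm" "'f trm"
  | Rel 'r "'f trm list"
  | Neg "('f, 'r) form"
  | Conj "('f, 'r) form" "('f, 'r) form"
  | Exist nat "('f, 'r) form"

primrec trm_wf :: "('f, 'r) signature \<Rightarrow> 'f trm \<Rightarrow> bool" where
  "trm_wf L (Var i) = True"
| "trm_wf L (Fn g ts) = (fun_ar L g = Some (length ts) \<and> list_all (trm_wf L) ts)"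

primrec form_wf :: "('f, 'r) signature \<Rightarrow> ('f, 'r) form \<Rightarrow> bool" where
  "form_wf L (Equal s t) = (trm_wf L s \<and> trm_wf L t)"
| "form_wf L (Rel r ts) = (rel_ar L r = Some (length ts) \<and> list_all (trm_wf L) ts)"
| "form_wf L (Neg \<phi>) = form_wf L \<phi>"
| "form_wf L (Conj \<phi> \<psi>) = (form_wf L \<phi> \<and> form_wf L \<psi>)"
| "form_wf L (Exist i \<phi>) = form_wf L \<phi>"

record ('a, 'f, 'r) fo_structure =
  univ :: "'a set"
  fint :: "'f \<Rightarrow> 'a list \<Rightarrow> 'a"
  rint :: "'r \<Rightarrow> 'a list \<Rightarrow> bool"

definition is_structure :: "('f, 'r) signature \<Rightarrow> ('a, 'f, 'r) fo_structure \<Rightarrow> bool" where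
  "is_structure L M \<longleftrightarrow> univ M \<noteq> {} \<and>
     (\<forall>g m xs. fun_ar L g = Some m \<longrightarrow> length xs = m \<longrightarrow> set xs \<subseteq> univ M \<longrightarrow> fint M g xs \<in> univ M)"

primrec trm_val :: "('a, 'f, 'r) fo_structure \<Rightarrow> (nat \<Rightarrow> 'a) \<Rightarrow> 'f trm \<Rightarrow> 'a" where
  "trm_val M e (Var i) = e i"
| "trm_val M e (Fn g ts) = fint M g (map (trm_val M e) ts)"

primrec sat :: "('a, 'f, 'r) fo_structure \<Rightarrow> (nat \<Rightarrow> 'a) \<Rightarrow> ('f, 'r) form \<Rightarrow> bool" where
  "sat M e (Equal s t) = (trm_val M e s = trm_val M e t)"
| "sat M e (Rel r ts) = rint M r (map (trm_val M e) ts)"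
| "sat M e (Neg \<phi>) = (\<not> sat M e \<phi>)"
| "sat M e (Conj \<phi> \<psi>) = (sat M e \<phi> \<and> sat M e \<psi>)"
| "sat M e (Exist i \<phi>) = (\<exists>a \<in> univ M. sat M (e(i := a)) \<phi>)"

text \<open>The values \<open>e i\<close> for \<open>i \<ge> n\<close> are the parameters; a formula has only finitely many free
  variables, so only finitely many of them matter.\<close>

definition definable_set ::
    "('f, 'r) signature \<Rightarrow> ('a, 'f, 'r) fo_structure \<Rightarrow> nat \<Rightarrow> 'a list set \<Rightarrow> bool" where
  "definable_set L M n D \<longleftrightarrow>
     (\<exists>\<phi> e. form_wf L \<phi> \<and> (\<forall>i. e i \<in> univ M) \<and>
        D = {xs. length xs = n \<and> set xs \<subseteq> univ M \<and>
                 sat M (\<lambda>i. if i < n then xs ! i else e i) \<phi>})"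

text \<open>An \<open>n\<close>-dimensional interpretation of \<open>N\<close> in \<open>M\<close> with parameters: a surjection \<open>f\<close> from a
  definable set \<open>D\<close> of \<open>n\<close>-tuples of \<open>M\<close> onto \<open>N\<close> such that the kernel of \<open>f\<close> and the preimages of
  the graphs of the functions and of the relations of \<open>N\<close> are definable in \<open>M\<close>. An \<open>m\<close>-tuple of
  \<open>n\<close>-tuples is regarded as an \<open>m * n\<close>-tuple by concatenation.\<close>

definition is_interpretation ::
    "('g, 's) signature \<Rightarrow> ('b, 'g, 's) fo_structure \<Rightarrow> ('f, 'r) signature \<Rightarrow> ('a, 'f, 'r) fo_structure
      \<Rightarrow> nat \<Rightarrow> 'a list set \<Rightarrow> ('a list \<Rightarrow> 'b) \<Rightarrow> bool" where
  "is_interpretation L' N L M n D f \<longleftrightarrow>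
     0 < n \<and> definable_set L M n D \<and> f ` D = univ N \<and>
     definable_set L M (2 * n) {xs @ ys | xs ys. xs \<in> D \<and> ys \<in> D \<and> f xs = f ys} \<and>
     (\<forall>g m. fun_ar L' g = Some m \<longrightarrow>
        definable_set L M ((m + 1) * n)
          {concat xss @ ys | xss ys. length xss = m \<and> set xss \<subseteq> D \<and> ys \<in> D \<and>
                                     f ys = fint N g (map f xss)}) \<and>
     (\<forall>r m. rel_ar L' r = Some m \<longrightarrow>
        definable_set L M (m * n)
          {concat xss | xss. length xss = m \<and> set xss \<subseteq> D \<and> rint N r (map f xss)})"

definition interpretable_in ::
    "('g, 's) signature \<Rightarrow> ('b, 'g, 's) fo_structure \<Rightarrow> ('f, 'r) signature \<Rightarrow> ('a, 'f, 'r) fo_structure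
      \<Rightarrow> bool" where
  "interpretable_in L' N L M \<longleftrightarrow> (\<exists>n D f. is_interpretation L' N L M n D f)"


section \<open>Groups and pairs of fields as first-order structures\<close>

datatype group_fun = GOne | GMult | GInv

text \<open>The language of groups has no relation symbols.\<close>

definition group_sig :: "(group_fun, unit) signature" where
  "group_sig = \<lparr>fun_ar = (\<lambda>s. Some (case s of GOne \<Rightarrow> 0 | GMult \<Rightarrow> 2 | GInv \<Rightarrow> 1)),
                rel_ar = (\<lambda>_. None)\<rparr>"

definition group_structure :: "('a, 'm) monoid_scheme \<Rightarrow> ('a, group_fun, unit) fo_structure" where
  "group_structure G =
     \<lparr>univ = carrier G,
      fint = (\<lambda>s xs. case s of GOne \<Rightarrow> \<one>\<^bsub>G\<^esub> | GMult \<Rightarrow> xs ! 0 \<otimes>\<^bsub>G\<^esub> xs ! 1 | GInv \<Rightarrow> inv\<^bsub>G\<^esub> (xs ! 0)),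
      rint = (\<lambda>_ _. False)\<rparr>"

lemma is_structure_group_structure:
  assumes "group G"
  shows "is_structure group_sig (group_structure G)"
proof -
  interpret group G by fact
  have "fint (group_structure G) g xs \<in> carrier G"
    if "fun_ar group_sig g = Some (length xs)" "set xs \<subseteq> carrier G" for g xs
  proof (cases g)
    case GMult
    with that have "length xs = 2" by (simp add: group_sig_def)
    then have "xs ! 0 \<in> carrier G" "xs ! 1 \<in> carrier G"
      using that(2) nth_mem[of 0 xs] nth_mem[of 1 xs] by auto
    then show ?thesis using GMult by (simp add: group_structure_def)
  next
    case GInv
    with that have "length xs = 1" by (simp add: group_sig_def)
    then have "xs ! 0 \<in> carrier G"
      using that(2) nth_mem[of 0 xs] by auto
    then show ?thesis using GInv by (simp add: group_structure_def)
  qed (simp add: group_structure_def)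
  then show ?thesis
    by (auto simp: is_structure_def group_structure_def)
qed

definition is_subfield :: "'a::field set \<Rightarrow> bool" where
  "is_subfield k \<longleftrightarrow> 0 \<in> k \<and> 1 \<in> k \<and> (\<forall>x\<in>k. \<forall>y\<in>k. x + y \<in> k \<and> x * y \<in> k) \<and>
     (\<forall>x\<in>k. - x \<in> k \<and> inverse x \<in> k)"

datatype field_fun = FZero | FOne | FPlus | FMinus | FTimes
datatype subfield_rel = InSubfield

definition field_pair_sig :: "(field_fun, subfield_rel) signature" where
  "field_pair_sig =
     \<lparr>fun_ar = (\<lambda>s. Some (case s of FZero \<Rightarrow> 0 | FOne \<Rightarrow> 0 | FPlus \<Rightarrow> 2 | FMinus \<Rightarrow> 1 | FTimes \<Rightarrow> 2)),
      rel_ar = (\<lambda>_. Some 1)\<rparr>"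

text \<open>The structure \<open>(K, k)\<close>, where \<open>K\<close> is the whole type.\<close>

definition field_pair :: "'a::field set \<Rightarrow> ('a, field_fun, subfield_rel) fo_structure" where
  "field_pair k =
     \<lparr>univ = UNIV,
      fint = (\<lambda>s xs. case s of FZero \<Rightarrow> 0 | FOne \<Rightarrow> 1 | FPlus \<Rightarrow> xs ! 0 + xs ! 1
                | FMinus \<Rightarrow> - (xs ! 0) | FTimes \<Rightarrow> xs ! 0 * xs ! 1),
      rint = (\<lambda>_ xs. xs ! 0 \<in> k)\<rparr>"

lemma is_structure_field_pair: "is_structure field_pair_sig (field_pair k)"
  by (simp add: is_structure_def field_pair_def)


section \<open>Group presentations\<close>

text \<open>In a word, the letter \<open>(g, True)\<close> stands for the generator \<open>g\<close> and \<open>(g, False)\<close> for its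
  formal inverse.\<close>

type_synonym 'g gword = "('g \<times> bool) list"

definition gwords :: "'g set \<Rightarrow> 'g gword set" where
  "gwords X = lists (X \<times> UNIV)"

definition gword_inv :: "'g gword \<Rightarrow> 'g gword" where
  "gword_inv w = rev (map (\<lambda>(g, b). (g, \<not> b)) w)"

text \<open>A pair \<open>(r, s) \<in> R\<close> stands for the defining relation \<open>r = s\<close>.\<close>

inductive pres_eq :: "'g set \<Rightarrow> ('g gword \<times> 'g gword) set \<Rightarrow> 'g gword \<Rightarrow> 'g gword \<Rightarrow> bool"
  for X R where
  refl: "w \<in> gwords X \<Longrightarrow> pres_eq X R w w"
| sym: "pres_eq X R v w \<Longrightarrow> pres_eq X R w v"
| trans: "pres_eq X R u v \<Longrightarrow> pres_eq X R v w \<Longrightarrow> pres_eq X R u w"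
| cancel: "u \<in> gwords X \<Longrightarrow> v \<in> gwords X \<Longrightarrow> g \<in> X \<Longrightarrow> pres_eq X R (u @ [(g, b), (g, \<not> b)] @ v) (u @ v)"
| rel: "(r, s) \<in> R \<Longrightarrow> r \<in> gwords X \<Longrightarrow> s \<in> gwords X \<Longrightarrow> u \<in> gwords X \<Longrightarrow> v \<in> gwords X
    \<Longrightarrow> pres_eq X R (u @ r @ v) (u @ s @ v)"

definition presented_group :: "'g set \<Rightarrow> ('g gword \<times> 'g gword) set \<Rightarrow> 'g gword set monoid" where
  "presented_group X R =
     \<lparr>carrier = gwords X // {(v, w). pres_eq X R v w},
      mult = (\<lambda>A B. {w. \<exists>u\<in>A. \<exists>v\<in>B. pres_eq X R (u @ v) w}),
      one = {w. pres_eq X R [] w}\<rparr>"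

lemma gwords_append [simp]: "u @ v \<in> gwords X \<longleftrightarrow> u \<in> gwords X \<and> v \<in> gwords X"
  by (auto simp: gwords_def)

lemma gwords_Nil [simp]: "[] \<in> gwords X"
  by (simp add: gwords_def)

lemma gword_inv_in_gwords: "w \<in> gwords X \<Longrightarrow> gword_inv w \<in> gwords X"
  by (auto simp: gwords_def gword_inv_def)

lemma pres_eq_in_gwords: "pres_eq X R v w \<Longrightarrow> v \<in> gwords X \<and> w \<in> gwords X"
  by (induction rule: pres_eq.induct) (auto simp: gwords_def)

lemma pres_eq_context:
  assumes "pres_eq X R v w" "p \<in> gwords X" "q \<in> gwords X"
  shows "pres_eq X R (p @ v @ q) (p @ w @ q)"
  using assms
proof (induction rule: pres_eq.induct)
  case (cancel u v g b)
  then show ?case using pres_eq.cancel[of "p @ u" X "v @ q" g R b] by simp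
next
  case (rel r s u v)
  then show ?case using pres_eq.rel[of r s R X "p @ u" "v @ q"] by simp
qed (auto intro: pres_eq.intros)

lemma pres_eq_append:
  assumes "pres_eq X R u u'" "pres_eq X R v v'"
  shows "pres_eq X R (u @ v) (u' @ v')"
  using pres_eq_context[OF assms(1), of "[]" v] pres_eq_context[OF assms(2), of u' "[]"]
    pres_eq_in_gwords[OF assms(1)] pres_eq_in_gwords[OF assms(2)]
  by (auto intro: pres_eq.trans)

lemma pres_eq_left_inverse: "w \<in> gwords X \<Longrightarrow> pres_eq X R (gword_inv w @ w) []"
proof (induction w)
  case Nil
  then show ?case by (auto simp: gword_inv_def intro: pres_eq.refl)
next
  case (Cons a w)
  obtain g b where a: "a = (g, b)" by (cases a)
  from Cons.prems a have w: "w \<in> gwords X" and g: "g \<in> X" by (auto simp: gwords_def)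
  have "pres_eq X R (gword_inv w @ [(g, \<not> b), (g, \<not> \<not> b)] @ w) (gword_inv w @ w)"
    by (rule pres_eq.cancel) (use w g gword_inv_in_gwords in auto)
  then show ?case
    using Cons.IH[OF w] by (auto simp: a gword_inv_def intro: pres_eq.trans)
qed

lemma group_presented_group: "group (presented_group X R)"
proof -
  define cls where "cls v = {w. pres_eq X R v w}" for v
  define G where "G = presented_group X R"
  have carr: "carrier G = cls ` gwords X"
    by (auto simp: G_def presented_group_def quotient_def cls_def)
  have one: "\<one>\<^bsub>G\<^esub> = cls []"
    by (simp add: G_def presented_group_def cls_def)
  have eqI: "cls u = cls v" if "pres_eq X R u v" for u v
    using that unfolding cls_def by (blast intro: pres_eq.sym pres_eq.trans)
  have mult: "cls u \<otimes>\<^bsub>G\<^esub> cls v = cls (u @ v)" if "u \<in> gwords X" "v \<in> gwords X" for u v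
  proof -
    have "w \<in> cls (u @ v)" if "w \<in> cls u \<otimes>\<^bsub>G\<^esub> cls v" for w
      using that unfolding G_def presented_group_def cls_def
      by (auto intro: pres_eq.trans pres_eq_append)
    moreover have "w \<in> cls u \<otimes>\<^bsub>G\<^esub> cls v" if "w \<in> cls (u @ v)" for w
      using that pres_eq.refl[OF \<open>u \<in> gwords X\<close>, of R] pres_eq.refl[OF \<open>v \<in> gwords X\<close>, of R]
      unfolding G_def presented_group_def cls_def by auto
    ultimately show ?thesis by blast
  qed
  have "group G"
  proof (rule groupI)
    fix x assume "x \<in> carrier G"
    then obtain w where w: "w \<in> gwords X" "x = cls w" by (auto simp: carr)
    then have "cls (gword_inv w) \<otimes>\<^bsub>G\<^esub> x = \<one>\<^bsub>G\<^esub>"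
      by (simp add: mult one gword_inv_in_gwords eqI pres_eq_left_inverse)
    then show "\<exists>y\<in>carrier G. y \<otimes>\<^bsub>G\<^esub> x = \<one>\<^bsub>G\<^esub>"
      using w gword_inv_in_gwords by (auto simp: carr)
  qed (auto simp: carr one mult)
  then show ?thesis by (simp add: G_def)
qed


section \<open>The group \<open>U(k, K)\<close>\<close>

text \<open>The positive root groups \<open>U\<^sub>1, \<dots>, U\<^sub>6\<close> are numbered in the cyclic order of the roots, so that
  odd indices belong to short roots and even ones to long roots. The generator \<open>(i, c)\<close> is
  \<open>x\<^sub>i(c)\<close>.\<close>

definition root_param :: "'a::field set \<Rightarrow> nat \<Rightarrow> 'a set" where
  "root_param k i = (if odd i then UNIV else k)"

definition U_gens :: "'a::field set \<Rightarrow> (nat \<times> 'a) set" where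
  "U_gens k = (SIGMA i:{1..6}. root_param k i)"

definition root_elt :: "nat \<Rightarrow> 'a::field \<Rightarrow> (nat \<times> 'a) gword" where
  "root_elt i c = [((i, c), True)]"

text \<open>The commutator is \<open>[u, v] = u\<^sup>-\<^sup>1 v\<^sup>-\<^sup>1 u v\<close>. The convention matters: with \<open>u v u\<^sup>-\<^sup>1 v\<^sup>-\<^sup>1\<close> the
  relations below would in general destroy the uniqueness of the decomposition of an element as a
  product in \<open>U\<^sub>1 \<dots> U\<^sub>6\<close>.\<close>

definition gcomm :: "'g gword \<Rightarrow> 'g gword \<Rightarrow> 'g gword" where
  "gcomm u v = gword_inv u @ gword_inv v @ u @ v"

definition U_rels :: "'a::field set \<Rightarrow> ((nat \<times> 'a) gword \<times> (nat \<times> 'a) gword) set" where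
  "U_rels k =
     {(root_elt i a @ root_elt i b, root_elt i (a + b)) | i a b. i \<in> {1..6} \<and> a \<in> root_param k i \<and> b \<in> root_param k i}
   \<union> {(gcomm (root_elt 1 a) (root_elt 5 b), root_elt 3 (- (a * b))) | a b. True}
   \<union> {(gcomm (root_elt 2 t) (root_elt 6 u), root_elt 4 (t * u)) | t u. t \<in> k \<and> u \<in> k}
   \<union> {(gcomm (root_elt 1 a) (root_elt 6 t),
        root_elt 2 (- (t * a ^ 3)) @ root_elt 3 (t * a ^ 2) @ root_elt 4 (t ^ 2 * a ^ 3) @ root_elt 5 (- (t * a))) | a t. t \<in> k}
   \<union> {(gcomm (root_elt i a) (root_elt j b), []) | i j a b. i \<in> {1..6} \<and> j \<in> {1..6} \<and> i < j \<and>
        (i, j) \<notin> {(1, 5), (2, 6), (1, 6)} \<and> a \<in> root_param k i \<and> b \<in> root_param k j}"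

text \<open>The hypotheses \<open>K\<^sup>3 \<subseteq> k\<close> and \<open>is_subfield k\<close> guarantee that both sides of every relation are
  words in the generators.\<close>

definition U_group :: "'a::field set \<Rightarrow> (nat \<times> 'a) gword set monoid" where
  "U_group k = presented_group (U_gens k) (U_rels k)"

lemma U_rels_in_gwords:
  assumes "is_subfield k" "range (\<lambda>a. a ^ 3) \<subseteq> k" "(r, s) \<in> U_rels k"
  shows "r \<in> gwords (U_gens k) \<and> s \<in> gwords (U_gens k)"
proof -
  have cube: "a ^ 3 \<in> k" for a using assms(2) by auto
  have gen: "root_elt i c \<in> gwords (U_gens k)" if "i \<in> {1..6}" "c \<in> root_param k i" for i c
    using that by (auto simp: root_elt_def gwords_def U_gens_def)
  show ?thesis
    using assms(3,1) cube
    by (auto simp: U_rels_def gcomm_def is_subfield_def power2_eq_square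
        intro!: gen gword_inv_in_gwords) (auto simp: root_param_def)
qed

lemma group_U_group: "group (U_group k)"
  unfolding U_group_def by (rule group_presented_group)

end

theory Submission
  imports Defs
begin

text \<open>Collecting from the left turns every word into a product \<open>x\<^sub>1(a\<^sub>1) \<dots> x\<^sub>6(a\<^sub>6)\<close>, and the group law
  on the exponents so obtained is polynomial. In characteristic \<open>3\<close> this law defines a group on the
  sextuples in which the defining relations hold; hence the normal form is unique, and \<open>U\<close> is
  interpreted in \<open>(K, k)\<close> without quantifiers.

  Conversely, \<open>c \<in> K\<close> is represented by \<open>x\<^sub>3(-c)\<close>. With \<open>p = x\<^sub>1(1)\<close>, \<open>q = x\<^sub>2(1) x\<^sub>5(1)\<close>, \<open>r = x\<^sub>6(1)\<close> as
  parameters, \<open>U\<^sub>3\<close> consists of the commutators \<open>[g, q]\<close> with \<open>g \<in> C(p)\<close>. Addition is the group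
  operation, the product of \<open>[g, q]\<close> and \<open>[p, h]\<close>, for \<open>g \<in> C(p)\<close> and \<open>h \<in> C(q)\<close>, is \<open>[g, h]\<close>, and \<open>k\<close>
  corresponds to the elements \<open>[p, [p, g]]\<close> with \<open>g \<in> C(r)\<close>.\<close>

section \<open>Words and presented groups\<close>

text \<open>The homomorphism from the free group that is induced by \<open>\<phi>\<close>, evaluated
  on unreduced words.\<close>

definition gword_eval :: "('b, 'm) monoid_scheme \<Rightarrow> ('g \<Rightarrow> 'b) \<Rightarrow> 'g gword \<Rightarrow> 'b" where
  "gword_eval G \<phi> w =
     foldr (\<lambda>(g, b) y. (if b then \<phi> g else inv\<^bsub>G\<^esub> (\<phi> g)) \<otimes>\<^bsub>G\<^esub> y) w \<one>\<^bsub>G\<^esub>"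

context group
begin

lemma gword_eval_closed:
  assumes "\<phi> \<in> X \<rightarrow> carrier G" "w \<in> gwords X"
  shows "gword_eval G \<phi> w \<in> carrier G"
  using assms(2)
  by (induction w) (use assms(1) in \<open>auto simp: gword_eval_def gwords_def Pi_iff\<close>)

lemma gword_eval_append:
  assumes "\<phi> \<in> X \<rightarrow> carrier G" "u \<in> gwords X" "v \<in> gwords X"
  shows "gword_eval G \<phi> (u @ v) = gword_eval G \<phi> u \<otimes> gword_eval G \<phi> v"
  using assms(2)
proof (induction u)
  case Nil
  then show ?case using gword_eval_closed[OF assms(1,3)] by (simp add: gword_eval_def)
next
  case (Cons a u)
  obtain g b where a: "a = (g, b)" by (cases a)
  have u: "u \<in> gwords X" and g: "g \<in> X" using Cons.prems a by (auto simp: gwords_def)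
  then have "\<phi> g \<in> carrier G" using assms(1) by auto
  then show ?case
    using Cons.IH[OF u] gword_eval_closed[OF assms(1) u] gword_eval_closed[OF assms(1,3)]
    by (simp add: a gword_eval_def m_assoc)
qed

lemma gword_eval_singleton:
  "\<phi> g \<in> carrier G \<Longrightarrow> gword_eval G \<phi> [(g, b)] = (if b then \<phi> g else inv (\<phi> g))"
  by (simp add: gword_eval_def)

text \<open>Von Dyck's theorem: an assignment that respects the defining relations factors through
  the presented group. Only the cancellation and relation steps of a derivation need an
  argument.\<close>

lemma gword_eval_pres_eq:
  assumes \<phi>: "\<phi> \<in> X \<rightarrow> carrier G"
    and R: "\<And>r s. (r, s) \<in> R \<Longrightarrow> r \<in> gwords X \<Longrightarrow> s \<in> gwords X
      \<Longrightarrow> gword_eval G \<phi> r = gword_eval G \<phi> s"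
    and "pres_eq X R v w"
  shows "gword_eval G \<phi> v = gword_eval G \<phi> w"
  using assms(3)
proof (induction rule: pres_eq.induct)
  case (cancel u v g b)
  have g: "[(g, b), (g, \<not> b)] \<in> gwords X" using cancel by (auto simp: gwords_def)
  have "gword_eval G \<phi> [(g, b), (g, \<not> b)] = \<one>"
    using cancel \<phi> by (auto simp: gword_eval_def Pi_iff)
  moreover have "gword_eval G \<phi> (u @ [(g, b), (g, \<not> b)] @ v) =
      gword_eval G \<phi> u \<otimes> (gword_eval G \<phi> [(g, b), (g, \<not> b)] \<otimes> gword_eval G \<phi> v)"
    using cancel g
    by (simp only: gword_eval_append[OF \<phi>] gwords_append simp_thms)
  ultimately show ?case
    using gword_eval_closed[OF \<phi> cancel(2)] cancel by (simp add: gword_eval_append[OF \<phi>])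
next
  case (rel r s u v)
  then show ?case by (simp add: gword_eval_append[OF \<phi>] R)
qed auto

text \<open>With the convention \<open>u\<^sup>-\<^sup>1 v\<^sup>-\<^sup>1 u v\<close> the
  commutator is a right factor, so commutator relations can be verified in a model without computing
  inverses.\<close>

lemma gword_eval_gcomm:
  assumes \<phi>: "\<phi> \<in> X \<rightarrow> carrier G" and g: "g \<in> X" and h: "h \<in> X" and z: "z \<in> carrier G"
  shows "gword_eval G \<phi> (gcomm [(g, True)] [(h, True)]) = z \<longleftrightarrow>
    \<phi> g \<otimes> \<phi> h = \<phi> h \<otimes> \<phi> g \<otimes> z"
proof -
  have c: "\<phi> g \<in> carrier G" "\<phi> h \<in> carrier G" using \<phi> g h by auto
  then have e: "gword_eval G \<phi> (gcomm [(g, True)] [(h, True)]) =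
      inv (\<phi> h \<otimes> \<phi> g) \<otimes> (\<phi> g \<otimes> \<phi> h)"
    by (simp add: gword_eval_def gcomm_def gword_inv_def inv_mult_group m_assoc)
  show ?thesis unfolding e
    using c z by (metis inv_solve_left m_closed inv_closed)
qed

text \<open>A commutator relation describes \<open>g h\<close>, whereas collecting starts from
  \<open>h g\<close>. Multiplying by the inverse \<open>w'\<close> of \<open>w\<close> turns the
  relation around; supplying \<open>w'\<close> explicitly means that it only has to be
  verified.\<close>

lemma swap_commutator:
  assumes "g \<otimes> h = h \<otimes> g \<otimes> w" "w \<otimes> w' = \<one>"
    "g \<in> carrier G" "h \<in> carrier G" "w \<in> carrier G" "w' \<in> carrier G"
  shows "h \<otimes> g = g \<otimes> h \<otimes> w'"
  using assms by (simp add: m_assoc)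

end

section \<open>Computing with classes of words\<close>

definition pres_class :: "'g set \<Rightarrow> ('g gword \<times> 'g gword) set \<Rightarrow> 'g gword \<Rightarrow> 'g gword set" where
  "pres_class X R v = {w. pres_eq X R v w}"

lemma carrier_presented_group: "carrier (presented_group X R) = pres_class X R ` gwords X"
  by (auto simp: presented_group_def quotient_def pres_class_def)

lemma one_presented_group: "\<one>\<^bsub>presented_group X R\<^esub> = pres_class X R []"
  by (simp add: presented_group_def pres_class_def)

text \<open>Classes of lists outside \<open>gwords X\<close> are empty, so the left-to-right
  direction depends on \<open>u\<close> being a word over \<open>X\<close>.\<close>

lemma pres_class_eq_iff:
  assumes "u \<in> gwords X"
  shows "pres_class X R u = pres_class X R v \<longleftrightarrow> pres_eq X R u v"
proof
  assume "pres_class X R u = pres_class X R v"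
  then have "u \<in> pres_class X R v" using pres_eq.refl[OF assms] by (auto simp: pres_class_def)
  then show "pres_eq X R u v" by (auto simp: pres_class_def intro: pres_eq.sym)
qed (auto simp: pres_class_def intro: pres_eq.sym pres_eq.trans)

lemma mult_presented_group:
  assumes "u \<in> gwords X" "v \<in> gwords X"
  shows "pres_class X R u \<otimes>\<^bsub>presented_group X R\<^esub> pres_class X R v = pres_class X R (u @ v)"
  using pres_eq.refl[OF assms(1), of R] pres_eq.refl[OF assms(2), of R]
  by (auto simp: presented_group_def pres_class_def intro: pres_eq.trans pres_eq_append)

lemma inv_presented_group:
  assumes "w \<in> gwords X"
  shows "inv\<^bsub>presented_group X R\<^esub> (pres_class X R w) = pres_class X R (gword_inv w)"
proof -
  interpret group "presented_group X R" by (rule group_presented_group)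
  show ?thesis
    by (rule inv_equality)
      (use assms in \<open>auto simp: mult_presented_group one_presented_group carrier_presented_group
        gword_inv_in_gwords pres_class_eq_iff intro!: pres_eq_left_inverse\<close>)
qed

lemma pres_class_relation:
  assumes "(r, s) \<in> R" "r \<in> gwords X" "s \<in> gwords X"
  shows "pres_class X R r = pres_class X R s"
  using pres_eq.rel[OF assms, of "[]" "[]"] assms by (simp add: pres_class_eq_iff)

lemma gword_inv_append: "gword_inv (u @ v) = gword_inv v @ gword_inv u"
  by (simp add: gword_inv_def)

text \<open>The counterpart of \<open>gword_eval_gcomm\<close> inside the presented group, where the
  commutator relation holds by definition and yields the exchange law for collecting.\<close>

lemma pres_class_gcomm:
  assumes "(gcomm u v, s) \<in> R" "u \<in> gwords X" "v \<in> gwords X" "s \<in> gwords X"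
  shows "pres_class X R u \<otimes>\<^bsub>presented_group X R\<^esub> pres_class X R v =
    pres_class X R v \<otimes>\<^bsub>presented_group X R\<^esub> pres_class X R u \<otimes>\<^bsub>presented_group X R\<^esub> pres_class X R s"
proof -
  let ?G = "presented_group X R" and ?c = "pres_class X R"
  interpret group ?G by (rule group_presented_group)
  have c: "?c u \<in> carrier ?G" "?c v \<in> carrier ?G" "?c s \<in> carrier ?G"
    using assms by (auto simp: carrier_presented_group)
  have g: "gcomm u v \<in> gwords X" using assms by (auto simp: gcomm_def gword_inv_in_gwords)
  have "?c s = ?c (gcomm u v)"
    using pres_class_relation[OF assms(1) g assms(4)] by simp
  also have "\<dots> = inv\<^bsub>?G\<^esub> (?c v \<otimes>\<^bsub>?G\<^esub> ?c u) \<otimes>\<^bsub>?G\<^esub> (?c u \<otimes>\<^bsub>?G\<^esub> ?c v)"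
    using assms c by (simp add: inv_mult_group inv_presented_group mult_presented_group
        gword_inv_in_gwords gcomm_def gword_inv_append)
  finally show ?thesis
    using c by (metis inv_solve_left m_closed inv_closed)
qed

section \<open>Coordinates on \<open>U(k, K)\<close>\<close>

type_synonym 'a sextuple = "'a \<times> 'a \<times> 'a \<times> 'a \<times> 'a \<times> 'a"

text \<open>The multiplication law of the products \<open>x\<^sub>1(a\<^sub>1) \<dots> x\<^sub>6(a\<^sub>6)\<close>, obtained by collecting from the
  left. The coefficient of \<open>a\<^sub>6\<^sup>2 b\<^sub>1\<^sup>3\<close> comes out as \<open>-2\<close>, which is \<open>1\<close> in characteristic \<open>3\<close>.\<close>

fun umul :: "'a::field sextuple \<Rightarrow> 'a sextuple \<Rightarrow> 'a sextuple" where
  "umul (a1, a2, a3, a4, a5, a6) (b1, b2, b3, b4, b5, b6) =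
     (a1 + b1,
      a2 + b2 + a6 * b1 ^ 3,
      a3 + b3 + b1 * a5 - a6 * b1 ^ 2,
      a4 + b4 + a6 ^ 2 * b1 ^ 3 - a6 * b2,
      a5 + b5 + a6 * b1,
      a6 + b6)"

definition ucarrier :: "'a::field set \<Rightarrow> 'a sextuple set" where
  "ucarrier k = {(a1, a2, a3, a4, a5, a6). a2 \<in> k \<and> a4 \<in> k \<and> a6 \<in> k}"

definition utuple :: "nat \<Rightarrow> 'a::field \<Rightarrow> 'a sextuple" where
  "utuple i c =
     (if i = 1 then c else 0, if i = 2 then c else 0, if i = 3 then c else 0,
      if i = 4 then c else 0, if i = 5 then c else 0, if i = 6 then c else 0)"

definition ugroup :: "'a::field set \<Rightarrow> 'a sextuple monoid" where
  "ugroup k = \<lparr>carrier = ucarrier k, mult = umul, one = (0, 0, 0, 0, 0, 0)\<rparr>"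

lemma three_eq_0: "CHAR('a::field) = 3 \<Longrightarrow> (3::'a) = 0"
  using of_nat_CHAR[where 'a = 'a] by simp

text \<open>Over the integers associativity fails only by multiples of three: cubing has to be
  additive, and 2 has to be identified with -1.\<close>

lemma umul_assoc:
  assumes "(3::'a::field) = 0"
  shows "umul (umul x y) z = umul x (umul y z :: 'a sextuple)"
proof -
  obtain a1 a2 a3 a4 a5 a6 where x: "x = (a1, a2, a3, a4, a5, a6)" by (cases x)
  obtain b1 b2 b3 b4 b5 b6 where y: "y = (b1, b2, b3, b4, b5, b6)" by (cases y)
  obtain c1 c2 c3 c4 c5 c6 where z: "z = (c1, c2, c3, c4, c5, c6)" by (cases z)
  \<comment> \<open>In each coordinate below, \<open>w\<close> is a third of the difference of the
    two sides, found by expanding.\<close>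
  have eqI: "u = v" if "u - v = 3 * w" for u v w :: 'a using that assms by simp
  show ?thesis unfolding x y z umul.simps prod.inject
  proof (intro conjI)
    show "a2 + b2 + a6 * b1 ^ 3 + c2 + (a6 + b6) * c1 ^ 3 =
        a2 + (b2 + c2 + b6 * c1 ^ 3) + a6 * (b1 + c1) ^ 3"
      by (rule eqI[of _ _ "- a6 * (b1 ^ 2 * c1 + b1 * c1 ^ 2)"])
        (simp add: power2_eq_square power3_eq_cube algebra_simps)
    show "a3 + b3 + b1 * a5 - a6 * b1 ^ 2 + c3 + c1 * (a5 + b5 + a6 * b1) - (a6 + b6) * c1 ^ 2 =
        a3 + (b3 + c3 + c1 * b5 - b6 * c1 ^ 2) + (b1 + c1) * a5 - a6 * (b1 + c1) ^ 2"
      by (rule eqI[of _ _ "a6 * b1 * c1"]) (simp add: power2_eq_square algebra_simps)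
    show "a4 + b4 + a6 ^ 2 * b1 ^ 3 - a6 * b2 + c4 + (a6 + b6) ^ 2 * c1 ^ 3 - (a6 + b6) * c2 =
        a4 + (b4 + c4 + b6 ^ 2 * c1 ^ 3 - b6 * c2) + a6 ^ 2 * (b1 + c1) ^ 3 -
        a6 * (b2 + c2 + b6 * c1 ^ 3)"
      by (rule eqI[of _ _ "a6 * b6 * c1 ^ 3 - a6 ^ 2 * (b1 ^ 2 * c1 + b1 * c1 ^ 2)"])
        (simp add: power2_eq_square power3_eq_cube algebra_simps)
  qed (simp_all add: algebra_simps)
qed

section \<open>The group of sextuples over a pair of fields\<close>

locale subfield_cubes =
  fixes k :: "'a::field set"
  assumes char3: "(3::'a) = 0"
    and subfield: "is_subfield k"
    and cubes: "a ^ 3 \<in> k"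
begin

lemma three_mult: "x + 2 * x = (0::'a)"
proof -
  have "x + 2 * x = 3 * x" by (simp add: algebra_simps)
  then show ?thesis using char3 by simp
qed

lemma k_closed [simp]:
  "0 \<in> k" "1 \<in> k" "s \<in> k \<Longrightarrow> t \<in> k \<Longrightarrow> s + t \<in> k" "s \<in> k \<Longrightarrow> t \<in> k \<Longrightarrow> s * t \<in> k"
  "s \<in> k \<Longrightarrow> - s \<in> k" "a ^ 3 \<in> k"
  using subfield cubes by (auto simp: is_subfield_def)

lemma k_closed_diff_power [simp]: "s \<in> k \<Longrightarrow> t \<in> k \<Longrightarrow> s - t \<in> k" "s \<in> k \<Longrightarrow> s ^ n \<in> k"
  using k_closed(3)[of s "- t"] by (simp_all del: k_closed(3)) (induction n, auto)

text \<open>Closure of the carrier rests on \<open>cubes\<close>: the second and fourth coordinates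
  of \<open>umul\<close> contain the cube of \<open>b1\<close>, an arbitrary element of
  \<open>K\<close>.\<close>

lemma group_ugroup: "group (ugroup k)"
proof (rule groupI)
  fix x assume x: "x \<in> carrier (ugroup k)"
  obtain a1 a2 a3 a4 a5 a6 where e: "x = (a1, a2, a3, a4, a5, a6)" by (cases x)
  \<comment> \<open>The left inverse, found by solving for coordinates 1 and 6 first, then 2 and 5,
    then 3 and 4.\<close>
  let ?y = "(- a1, - a2 + a6 * a1 ^ 3, - (a3 + a1 * (a6 * a1 - a5) + a6 * a1 ^ 2),
    - (a4 + a6 ^ 2 * a1 ^ 3 + a6 * a2), - a5 + a6 * a1, - a6)"
  have "?y \<in> carrier (ugroup k)" using x by (simp add: e ugroup_def ucarrier_def)
  moreover have "?y \<otimes>\<^bsub>ugroup k\<^esub> x = \<one>\<^bsub>ugroup k\<^esub>"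
    by (simp add: e ugroup_def algebra_simps)
  ultimately show "\<exists>y\<in>carrier (ugroup k). y \<otimes>\<^bsub>ugroup k\<^esub> x = \<one>\<^bsub>ugroup k\<^esub>" by blast
qed (use umul_assoc[OF char3] in \<open>auto simp: ugroup_def ucarrier_def\<close>)

lemma utuple_closed: "(i, c) \<in> U_gens k \<Longrightarrow> utuple i c \<in> ucarrier k"
  by (auto simp: U_gens_def root_param_def utuple_def ucarrier_def split: if_splits)

lemma root_elt_in_gwords: "i \<in> {1..6} \<Longrightarrow> c \<in> root_param k i \<Longrightarrow> root_elt i c \<in> gwords (U_gens k)"
  by (auto simp: root_elt_def gwords_def U_gens_def)

section \<open>Evaluating words in the group of sextuples\<close>

definition ueval :: "(nat \<times> 'a) gword \<Rightarrow> 'a sextuple" where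
  "ueval = gword_eval (ugroup k) (\<lambda>(i, c). utuple i c)"

lemma utuple_funcset: "(\<lambda>(i, c). utuple i c) \<in> U_gens k \<rightarrow> carrier (ugroup k)"
  using utuple_closed by (auto simp: ugroup_def)

lemma ueval_append:
  "u \<in> gwords (U_gens k) \<Longrightarrow> v \<in> gwords (U_gens k) \<Longrightarrow> ueval (u @ v) = umul (ueval u) (ueval v)"
  unfolding ueval_def
  by (subst group.gword_eval_append[OF group_ugroup utuple_funcset]) (simp_all add: ugroup_def)

lemma ueval_root_elt:
  "i \<in> {1..6} \<Longrightarrow> c \<in> root_param k i \<Longrightarrow> ueval (root_elt i c) = utuple i c"
  using utuple_closed[of i c]
  by (subst ueval_def, unfold root_elt_def, subst group.gword_eval_singleton[OF group_ugroup])
    (auto simp: ugroup_def U_gens_def)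

lemma ueval_Nil: "ueval [] = (0, 0, 0, 0, 0, 0)"
  by (simp add: ueval_def gword_eval_def ugroup_def)

lemma ueval_gcomm:
  assumes "i \<in> {1..6}" "a \<in> root_param k i" "j \<in> {1..6}" "b \<in> root_param k j" "z \<in> ucarrier k"
  shows "ueval (gcomm (root_elt i a) (root_elt j b)) = z \<longleftrightarrow>
    umul (utuple i a) (utuple j b) = umul (umul (utuple j b) (utuple i a)) z"
  using group.gword_eval_gcomm[OF group_ugroup utuple_funcset, of "(i, a)" "(j, b)" z] assms
  by (simp add: ueval_def root_elt_def U_gens_def ugroup_def)

text \<open>This makes \<open>ueval\<close> well defined on \<open>U\<close>. By
  \<open>ueval_gcomm\<close> each commutator relation becomes a polynomial identity between products
  of sextuples.\<close>

lemma ueval_rels: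
  assumes "(r, s) \<in> U_rels k"
  shows "ueval r = ueval s"
proof -
  have odd: "c \<in> root_param k i" if "odd i" for c i using that by (simp add: root_param_def)
  have even: "c \<in> root_param k i" if "even i" "c \<in> k" for c i using that by (simp add: root_param_def)
  from assms consider
    (add) i a b where "r = root_elt i a @ root_elt i b" "s = root_elt i (a + b)"
      "i \<in> {1..6}" "a \<in> root_param k i" "b \<in> root_param k i"
  | (c15) a b where "r = gcomm (root_elt 1 a) (root_elt 5 b)" "s = root_elt 3 (- (a * b))"
  | (c26) t u where "r = gcomm (root_elt 2 t) (root_elt 6 u)" "s = root_elt 4 (t * u)" "t \<in> k" "u \<in> k"
  | (c16) a t where "r = gcomm (root_elt 1 a) (root_elt 6 t)"
      "s = root_elt 2 (- (t * a ^ 3)) @ root_elt 3 (t * a ^ 2) @ root_elt 4 (t ^ 2 * a ^ 3) @ root_elt 5 (- (t * a))"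
      "t \<in> k"
  | (comm) i j a b where "r = gcomm (root_elt i a) (root_elt j b)" "s = []" "i \<in> {1..6}" "j \<in> {1..6}"
      "i < j" "(i, j) \<notin> {(1, 5), (2, 6), (1, 6)}" "a \<in> root_param k i" "b \<in> root_param k j"
    unfolding U_rels_def
    by (elim UnE CollectE exE conjE Pair_inject)
      ((rule that(1); assumption) | (rule that(2); assumption) | (rule that(3); assumption) |
        (rule that(4); assumption) | (rule that(5); assumption))+
  then show ?thesis
  proof cases
    case add
    moreover have "a + b \<in> root_param k i" using add by (auto simp: root_param_def split: if_splits)
    moreover have "umul (utuple i a) (utuple i b) = utuple i (a + b)"
      by (simp add: utuple_def)
    ultimately show ?thesis by (simp add: ueval_append root_elt_in_gwords ueval_root_elt)
  next
    case c15
    have "umul (utuple 1 a) (utuple 5 b) = umul (umul (utuple 5 b) (utuple 1 a)) (utuple 3 (- (a * b)))"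
      by (simp add: utuple_def)
    then show ?thesis using c15
      by (subst c15(1), subst ueval_gcomm) (auto simp: odd ueval_root_elt utuple_def ucarrier_def)
  next
    case c26
    have "umul (utuple 2 t) (utuple 6 u) = umul (umul (utuple 6 u) (utuple 2 t)) (utuple 4 (t * u))"
      by (simp add: utuple_def)
    then show ?thesis using c26
      by (subst c26(1), subst ueval_gcomm) (auto simp: even ueval_root_elt utuple_def ucarrier_def)
  next
    case c16
    have s: "ueval s = (0, - (t * a ^ 3), t * a ^ 2, t ^ 2 * a ^ 3, - (t * a), 0)"
      using c16 by (simp add: ueval_append root_elt_in_gwords ueval_root_elt odd even utuple_def)
    \<comment> \<open>Characteristic three enters in the fourth coordinate, where the sides differ
      by \<open>3 * t ^ 2 * a ^ 3\<close>.\<close>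
    have "umul (utuple 1 a) (utuple 6 t) = umul (umul (utuple 6 t) (utuple 1 a)) (ueval s)"
      using three_mult[of "t ^ 2 * a ^ 3"] unfolding s by (simp add: utuple_def power2_eq_square algebra_simps)
    then show ?thesis using c16 unfolding s
      by (subst c16(1), subst ueval_gcomm) (auto simp: odd even s ucarrier_def)
  next
    case comm
    have "umul (utuple i a) (utuple j b) = umul (umul (utuple j b) (utuple i a)) (0, 0, 0, 0, 0, 0)"
    proof -
      have "i = 1 \<or> i = 2 \<or> i = 3 \<or> i = 4 \<or> i = 5" "j = 2 \<or> j = 3 \<or> j = 4 \<or> j = 5 \<or> j = 6"
        using comm(3-5) by auto
      then show ?thesis
        using comm(5,6) by (elim disjE) (simp_all add: utuple_def)
    qed
    then show ?thesis using comm
      by (subst comm(1), subst ueval_gcomm) (auto simp: ueval_Nil ucarrier_def)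
  qed
qed

lemma ueval_pres_eq:
  assumes "pres_eq (U_gens k) (U_rels k) v w"
  shows "ueval v = ueval w"
  unfolding ueval_def
  by (rule group.gword_eval_pres_eq[OF group_ugroup utuple_funcset _ assms])
    (rule ueval_rels[unfolded ueval_def])

section \<open>Collecting in \<open>U\<close>\<close>

abbreviation "UG \<equiv> U_group k"

definition x_elt :: "nat \<Rightarrow> 'a \<Rightarrow> (nat \<times> 'a) gword set" where
  "x_elt i c = pres_class (U_gens k) (U_rels k) (root_elt i c)"

lemma x_elt_closed [simp]: "i \<in> {1..6} \<Longrightarrow> c \<in> root_param k i \<Longrightarrow> x_elt i c \<in> carrier UG"
  by (simp add: U_group_def carrier_presented_group x_elt_def root_elt_in_gwords)

lemma x_elt_add:
  assumes "i \<in> {1..6}" "a \<in> root_param k i" "b \<in> root_param k i"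
  shows "x_elt i a \<otimes>\<^bsub>UG\<^esub> x_elt i b = x_elt i (a + b)"
proof -
  have "a + b \<in> root_param k i" using assms by (auto simp: root_param_def split: if_splits)
  moreover have "(root_elt i a @ root_elt i b, root_elt i (a + b)) \<in> U_rels k"
    unfolding U_rels_def using assms by (intro UnI1) blast
  ultimately show ?thesis
    using assms by (simp add: U_group_def x_elt_def mult_presented_group root_elt_in_gwords
        pres_class_relation)
qed

lemma x_elt_gcomm:
  assumes "(gcomm (root_elt i a) (root_elt j b), s) \<in> U_rels k"
    "i \<in> {1..6}" "a \<in> root_param k i" "j \<in> {1..6}" "b \<in> root_param k j" "s \<in> gwords (U_gens k)"
  shows "x_elt i a \<otimes>\<^bsub>UG\<^esub> x_elt j b =
    x_elt j b \<otimes>\<^bsub>UG\<^esub> x_elt i a \<otimes>\<^bsub>UG\<^esub> pres_class (U_gens k) (U_rels k) s"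
  unfolding U_group_def x_elt_def
  by (rule pres_class_gcomm) (use assms in \<open>auto intro: root_elt_in_gwords\<close>)

sublocale UG: group "U_group k"
  by (rule group_U_group)

text \<open>By additivity the element is idempotent, and the identity is the only idempotent of a
  group.\<close>

lemma x_elt_0:
  assumes "i \<in> {1..6}"
  shows "x_elt i 0 = \<one>\<^bsub>UG\<^esub>"
proof -
  have z: "0 \<in> root_param k i" by (simp add: root_param_def)
  show ?thesis using x_elt_add[OF assms z z] x_elt_closed[OF assms z] by (simp add: UG.l_cancel_one)
qed

text \<open>Oriented for rewriting: the factor with the smaller index moves to the left.\<close>

lemma x_elt_commute:
  assumes "i \<in> {1..6}" "j \<in> {1..6}" "i < j" "(i, j) \<notin> {(1, 5), (2, 6), (1, 6)}"
    "a \<in> root_param k i" "b \<in> root_param k j"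
  shows "x_elt j b \<otimes>\<^bsub>UG\<^esub> x_elt i a = x_elt i a \<otimes>\<^bsub>UG\<^esub> x_elt j b"
proof -
  have "(gcomm (root_elt i a) (root_elt j b), []) \<in> U_rels k"
    unfolding U_rels_def using assms by (intro UnI2) blast
  from x_elt_gcomm[OF this] assms show ?thesis
    by (simp add: U_group_def one_presented_group[symmetric]) (simp flip: U_group_def)
qed

lemma odd_param [simp]: "odd i \<Longrightarrow> c \<in> root_param k i"
  by (simp add: root_param_def)

lemma even_param [simp]: "even i \<Longrightarrow> c \<in> root_param k i \<longleftrightarrow> c \<in> k"
  by (simp add: root_param_def)

lemma x_elt_51:
  "x_elt 5 b \<otimes>\<^bsub>UG\<^esub> x_elt 1 a = x_elt 1 a \<otimes>\<^bsub>UG\<^esub> (x_elt 3 (a * b) \<otimes>\<^bsub>UG\<^esub> x_elt 5 b)"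
proof -
  have "(gcomm (root_elt 1 a) (root_elt 5 b), root_elt 3 (- (a * b))) \<in> U_rels k"
    unfolding U_rels_def by (intro UnI1[OF UnI1[OF UnI1[OF UnI2]]]) blast
  from UG.swap_commutator[OF x_elt_gcomm[OF this], of "x_elt 3 (a * b)"] show ?thesis
    by (simp add: root_elt_in_gwords x_elt_def[symmetric] x_elt_add x_elt_0 UG.m_assoc x_elt_commute[of 3 5])
qed

lemma x_elt_62:
  assumes "t \<in> k" "u \<in> k"
  shows "x_elt 6 u \<otimes>\<^bsub>UG\<^esub> x_elt 2 t = x_elt 2 t \<otimes>\<^bsub>UG\<^esub> (x_elt 4 (- (u * t)) \<otimes>\<^bsub>UG\<^esub> x_elt 6 u)"
proof -
  have "(gcomm (root_elt 2 t) (root_elt 6 u), root_elt 4 (t * u)) \<in> U_rels k"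
    unfolding U_rels_def using assms by (intro UnI1[OF UnI1[OF UnI2]]) blast
  from UG.swap_commutator[OF x_elt_gcomm[OF this], of "x_elt 4 (- (u * t))"] assms show ?thesis
    by (simp add: root_elt_in_gwords x_elt_def[symmetric] x_elt_add x_elt_0 UG.m_assoc x_elt_commute[of 4 6] mult.commute)
qed

text \<open>In products nested to the right, \<open>g \<otimes> h\<close> is not a subterm; this
  lifts a rule for two adjacent factors to that position.\<close>

lemma m_rotate:
  assumes "g \<otimes>\<^bsub>UG\<^esub> h = r" "g \<in> carrier UG" "h \<in> carrier UG" "z \<in> carrier UG"
  shows "g \<otimes>\<^bsub>UG\<^esub> (h \<otimes>\<^bsub>UG\<^esub> z) = r \<otimes>\<^bsub>UG\<^esub> z"
  using assms by (simp flip: UG.m_assoc)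

text \<open>The moves of the collection other than \<open>x\<^sub>6\<close> past
  \<open>x\<^sub>1\<close>: merging factors of one root group and exchanging neighbours.\<close>

lemmas collect_abelian =
  x_elt_add m_rotate[OF x_elt_add] x_elt_commute[of 5 6] m_rotate[OF x_elt_commute]
  m_rotate[OF x_elt_62] m_rotate[OF x_elt_51] x_elt_62 x_elt_51

text \<open>Moving \<open>x\<^sub>6\<close> past \<open>x\<^sub>1\<close> leaves the inverse
  commutator behind \<open>x\<^sub>6\<close>, which then still has to pass \<open>x\<^sub>2\<close>;
  this second move produces another factor from \<open>U\<^sub>4\<close>.\<close>

lemma x_elt_61:
  assumes "t \<in> k"
  shows "x_elt 6 t \<otimes>\<^bsub>UG\<^esub> x_elt 1 a = x_elt 1 a \<otimes>\<^bsub>UG\<^esub> (x_elt 2 (t * a ^ 3) \<otimes>\<^bsub>UG\<^esub>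
    (x_elt 3 (- (t * a ^ 2)) \<otimes>\<^bsub>UG\<^esub> (x_elt 4 (t ^ 2 * a ^ 3) \<otimes>\<^bsub>UG\<^esub> (x_elt 5 (t * a) \<otimes>\<^bsub>UG\<^esub> x_elt 6 t))))"
proof -
  let ?s = "root_elt 2 (- (t * a ^ 3)) @ root_elt 3 (t * a ^ 2) @ root_elt 4 (t ^ 2 * a ^ 3) @ root_elt 5 (- (t * a))"
  \<comment> \<open>The inverse of the commutator. Its factors lie in \<open>U\<^sub>2\<close>, ...,
    \<open>U\<^sub>5\<close>, which commute with each other, so the exponents are negated one by
    one.\<close>
  let ?s' = "x_elt 2 (t * a ^ 3) \<otimes>\<^bsub>UG\<^esub> (x_elt 3 (- (t * a ^ 2)) \<otimes>\<^bsub>UG\<^esub> (x_elt 4 (- (t ^ 2 * a ^ 3)) \<otimes>\<^bsub>UG\<^esub> x_elt 5 (t * a)))"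
  have "(gcomm (root_elt 1 a) (root_elt 6 t), ?s) \<in> U_rels k"
    unfolding U_rels_def using assms by (intro UnI1[OF UnI2]) blast
  from x_elt_gcomm[OF this] assms
  have "x_elt 1 a \<otimes>\<^bsub>UG\<^esub> x_elt 6 t = x_elt 6 t \<otimes>\<^bsub>UG\<^esub> x_elt 1 a \<otimes>\<^bsub>UG\<^esub>
      (x_elt 2 (- (t * a ^ 3)) \<otimes>\<^bsub>UG\<^esub> (x_elt 3 (t * a ^ 2) \<otimes>\<^bsub>UG\<^esub> (x_elt 4 (t ^ 2 * a ^ 3) \<otimes>\<^bsub>UG\<^esub> x_elt 5 (- (t * a)))))"
    by (simp add: root_elt_in_gwords U_group_def x_elt_def mult_presented_group)
  from UG.swap_commutator[OF this, of ?s'] assms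
  have "x_elt 6 t \<otimes>\<^bsub>UG\<^esub> x_elt 1 a = x_elt 1 a \<otimes>\<^bsub>UG\<^esub> (x_elt 6 t \<otimes>\<^bsub>UG\<^esub> ?s')"
    by (simp add: UG.m_assoc x_elt_0 collect_abelian del: One_nat_def)
  also have "x_elt 6 t \<otimes>\<^bsub>UG\<^esub> ?s' = x_elt 2 (t * a ^ 3) \<otimes>\<^bsub>UG\<^esub>
    (x_elt 3 (- (t * a ^ 2)) \<otimes>\<^bsub>UG\<^esub> (x_elt 4 (- (t * (t * a ^ 3)) - t ^ 2 * a ^ 3) \<otimes>\<^bsub>UG\<^esub> (x_elt 5 (t * a) \<otimes>\<^bsub>UG\<^esub> x_elt 6 t)))"
    using assms by (simp add: UG.m_assoc collect_abelian)
  \<comment> \<open>One summand comes from \<open>x\<^sub>6\<close> passing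
    \<open>x\<^sub>2\<close>, the other from the commutator; here -2 becomes 1.\<close>
  also have "- (t * (t * a ^ 3)) - t ^ 2 * a ^ 3 = t ^ 2 * a ^ 3"
    using three_mult[of "t ^ 2 * a ^ 3"] by (simp add: power2_eq_square algebra_simps)
  finally show ?thesis .
qed

fun u_elt :: "'a sextuple \<Rightarrow> (nat \<times> 'a) gword set" where
  "u_elt (a1, a2, a3, a4, a5, a6) = x_elt 1 a1 \<otimes>\<^bsub>UG\<^esub> (x_elt 2 a2 \<otimes>\<^bsub>UG\<^esub> (x_elt 3 a3 \<otimes>\<^bsub>UG\<^esub>
     (x_elt 4 a4 \<otimes>\<^bsub>UG\<^esub> (x_elt 5 a5 \<otimes>\<^bsub>UG\<^esub> x_elt 6 a6))))"

lemma u_elt_closed: "x \<in> ucarrier k \<Longrightarrow> u_elt x \<in> carrier UG"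
  by (auto simp: ucarrier_def)

lemma umul_closed: "x \<in> ucarrier k \<Longrightarrow> y \<in> ucarrier k \<Longrightarrow> umul x y \<in> ucarrier k"
  by (auto simp: ucarrier_def)

text \<open>Rewriting with the collection rules puts the factors in ascending order, and the
  exponents that result are those of \<open>umul\<close>.\<close>

lemma u_elt_mult:
  assumes "x \<in> ucarrier k" "y \<in> ucarrier k"
  shows "u_elt x \<otimes>\<^bsub>UG\<^esub> u_elt y = u_elt (umul x y)"
proof -
  obtain a1 a2 a3 a4 a5 a6 where x: "x = (a1, a2, a3, a4, a5, a6)" by (cases x)
  obtain b1 b2 b3 b4 b5 b6 where y: "y = (b1, b2, b3, b4, b5, b6)" by (cases y)
  have k: "a2 \<in> k" "a4 \<in> k" "a6 \<in> k" "b2 \<in> k" "b4 \<in> k" "b6 \<in> k"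
    using assms by (auto simp: x y ucarrier_def)
  show ?thesis unfolding x y
    using k by (simp add: UG.m_assoc x_elt_61 m_rotate[OF x_elt_61] collect_abelian algebra_simps del: One_nat_def)
qed

section \<open>Existence and uniqueness of the normal form\<close>

fun uword :: "'a sextuple \<Rightarrow> (nat \<times> 'a) gword" where
  "uword (a1, a2, a3, a4, a5, a6) =
     root_elt 1 a1 @ root_elt 2 a2 @ root_elt 3 a3 @ root_elt 4 a4 @ root_elt 5 a5 @ root_elt 6 a6"

lemma uword_in_gwords: "x \<in> ucarrier k \<Longrightarrow> uword x \<in> gwords (U_gens k)"
  by (auto simp: ucarrier_def root_elt_in_gwords)

lemma u_elt_eq_pres_class: "x \<in> ucarrier k \<Longrightarrow> u_elt x = pres_class (U_gens k) (U_rels k) (uword x)"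
  by (auto simp: ucarrier_def U_group_def x_elt_def mult_presented_group root_elt_in_gwords)

lemma ueval_uword: "x \<in> ucarrier k \<Longrightarrow> ueval (uword x) = x"
  by (auto simp: ucarrier_def ueval_append root_elt_in_gwords ueval_root_elt)
    (simp_all add: utuple_def)

text \<open>Distinct exponents give distinct elements because \<open>ueval\<close> is constant on
  classes and recovers the exponents from \<open>uword\<close>.\<close>

lemma u_elt_eq_iff:
  assumes "x \<in> ucarrier k" "y \<in> ucarrier k"
  shows "u_elt x = u_elt y \<longleftrightarrow> x = y"
  using assms ueval_pres_eq[of "uword x" "uword y"]
  by (auto simp: u_elt_eq_pres_class pres_class_eq_iff uword_in_gwords ueval_uword intro: pres_eq.refl)

lemma u_elt_utuple:
  assumes "i \<in> {1..6}" "c \<in> root_param k i"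
  shows "u_elt (utuple i c) = x_elt i c"
proof -
  have "i = 1 \<or> i = 2 \<or> i = 3 \<or> i = 4 \<or> i = 5 \<or> i = 6" using assms(1) by auto
  then show ?thesis
    using assms(2) by (elim disjE) (simp_all add: utuple_def x_elt_0)
qed

text \<open>A word is collected from its right end: each further letter multiplies a normal form
  from the left, and \<open>u_elt_mult\<close> applies.\<close>

lemma u_elt_image: "u_elt ` ucarrier k = carrier UG"
proof
  show "carrier UG \<subseteq> u_elt ` ucarrier k"
  proof
    fix z assume "z \<in> carrier UG"
    then obtain w where "w \<in> gwords (U_gens k)" "z = pres_class (U_gens k) (U_rels k) w"
      by (auto simp: U_group_def carrier_presented_group)
    moreover have "pres_class (U_gens k) (U_rels k) w \<in> u_elt ` ucarrier k"
      if "w \<in> gwords (U_gens k)" for w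
      using that
    proof (induction w)
      case Nil
      have "u_elt (0, 0, 0, 0, 0, 0) = pres_class (U_gens k) (U_rels k) []"
        by (simp add: x_elt_0 U_group_def one_presented_group[symmetric])
          (simp add: x_elt_0 flip: U_group_def)
      then show ?case by (force simp: ucarrier_def)
    next
      case (Cons l w)
      obtain i c b where l: "l = ((i, c), b)" by (metis prod.exhaust)
      then have ic: "i \<in> {1..6}" "c \<in> root_param k i" and w: "w \<in> gwords (U_gens k)"
        and lw: "[l] \<in> gwords (U_gens k)"
        using Cons.prems by (auto simp: gwords_def U_gens_def)
      \<comment> \<open>The formal inverse of \<open>x\<^sub>i(c)\<close> has the class of
        \<open>x\<^sub>i(-c)\<close>, so every letter is a root element.\<close>
      define d where "d = (if b then c else - c)"
      have d: "d \<in> root_param k i" using ic by (auto simp: d_def root_param_def)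
      have "pres_class (U_gens k) (U_rels k) [l] = x_elt i d"
      proof (cases b)
        case True
        then show ?thesis by (simp add: l d_def x_elt_def root_elt_def)
      next
        case False
        then have "pres_class (U_gens k) (U_rels k) [l] = inv\<^bsub>UG\<^esub> x_elt i c"
          using ic by (simp add: U_group_def x_elt_def inv_presented_group root_elt_in_gwords)
            (simp add: l root_elt_def gword_inv_def)
        also have "\<dots> = x_elt i d"
          using ic d False by (intro UG.inv_equality) (simp_all add: x_elt_add x_elt_0 d_def)
        finally show ?thesis .
      qed
      moreover have "utuple i d \<in> ucarrier k" using d ic by (intro utuple_closed) (simp add: U_gens_def)
      moreover obtain y where "y \<in> ucarrier k" "pres_class (U_gens k) (U_rels k) w = u_elt y"
        using Cons.IH[OF w] by auto
      ultimately have "pres_class (U_gens k) (U_rels k) (l # w) = u_elt (umul (utuple i d) y)"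
        using mult_presented_group[OF lw w, of "U_rels k"] ic d
        by (simp add: U_group_def u_elt_utuple flip: u_elt_mult)
      then show ?case
        using umul_closed \<open>y \<in> ucarrier k\<close> \<open>utuple i d \<in> ucarrier k\<close> by blast
    qed
    ultimately show "z \<in> u_elt ` ucarrier k" by simp
  qed
qed (use u_elt_closed in auto)

end

section \<open>Interpretations\<close>

text \<open>The environment that occurs in \<open>definable_set\<close>: the tuple fills the first
  variables, and the parameters after it keep their own indices.\<close>

definition list_env :: "'a list \<Rightarrow> (nat \<Rightarrow> 'a) \<Rightarrow> nat \<Rightarrow> 'a" where
  "list_env xs e i = (if i < length xs then xs ! i else e i)"

lemma ex_concat:
  assumes "length zs = m * n"
  shows "\<exists>xss. length xss = m \<and> (\<forall>xs\<in>set xss. length xs = n) \<and> concat xss = zs"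
  using assms
proof (induction m arbitrary: zs)
  case (Suc m)
  then have "length (drop n zs) = m * n" by simp
  from Suc.IH[OF this] obtain xss where
    "length xss = m" "\<forall>xs\<in>set xss. length xs = n" "concat xss = drop n zs" by blast
  then show ?case using Suc.prems by (intro exI[of _ "take n zs # xss"]) auto
qed simp

text \<open>Domain, kernel, graphs and relations of an interpretation all consist of concatenations
  of \<open>m\<close> blocks of length \<open>n\<close>, so one criterion serves for all four.
  \<open>ex_concat\<close> recovers the blocks.\<close>

lemma definable_set_concat:
  assumes D: "\<And>xs. xs \<in> D \<Longrightarrow> length xs = n \<and> set xs \<subseteq> univ M"
    and \<phi>: "form_wf L \<phi>" and e: "\<And>i. e i \<in> univ M"
    and sat: "\<And>xss. length xss = m \<Longrightarrow> (\<And>xs. xs \<in> set xss \<Longrightarrow> length xs = n \<and> set xs \<subseteq> univ M) \<Longrightarrow>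
      sat M (list_env (concat xss) e) \<phi> \<longleftrightarrow> set xss \<subseteq> D \<and> R xss"
  shows "definable_set L M (m * n) {concat xss | xss. length xss = m \<and> set xss \<subseteq> D \<and> R xss}"
proof -
  have len: "length (concat xss) = m * n" if "length xss = m" "\<forall>xs\<in>set xss. length xs = n"
    for xss :: "'a list list" and m
    using that by (induction xss arbitrary: m) auto
  have "{concat xss | xss. length xss = m \<and> set xss \<subseteq> D \<and> R xss} =
    {zs. length zs = m * n \<and> set zs \<subseteq> univ M \<and> sat M (\<lambda>i. if i < m * n then zs ! i else e i) \<phi>}"
    (is "?A = ?B")
  proof (intro Set.set_eqI iffI)
    fix zs assume "zs \<in> ?A"
    then obtain xss where x: "zs = concat xss" "length xss = m" "set xss \<subseteq> D" "R xss" by blast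
    then have *: "length xs = n \<and> set xs \<subseteq> univ M" if "xs \<in> set xss" for xs using that D by blast
    then have l: "length zs = m * n" using len x by simp
    moreover have "set zs \<subseteq> univ M" using * x by auto
    moreover have "sat M (list_env zs e) \<phi>" using sat[of xss] * x by simp
    ultimately show "zs \<in> ?B" by (simp add: list_env_def[abs_def])
  next
    fix zs assume z: "zs \<in> ?B"
    then obtain xss where x: "length xss = m" "\<forall>xs\<in>set xss. length xs = n" "concat xss = zs"
      using ex_concat[of zs m n] by blast
    moreover have "set xs \<subseteq> univ M" if "xs \<in> set xss" for xs using that z x(3) by force
    ultimately have "length xs = n \<and> set xs \<subseteq> univ M" if "xs \<in> set xss" for xs using that by blast
    then show "zs \<in> ?A"
      using sat[of xss] x z by (auto simp: list_env_def[abs_def])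
  qed
  then show ?thesis unfolding definable_set_def using \<phi> e by blast
qed

text \<open>One environment \<open>e\<close> serves all formulas. Parameters are not shifted when
  tuples get longer, so they have to be stored beyond the longest tuple.\<close>

lemma interpretable_inI:
  fixes M :: "('a, 'f, 'r) fo_structure" and N :: "('b, 'g, 's) fo_structure"
  assumes n: "0 < n" and D: "\<And>xs. xs \<in> D \<Longrightarrow> length xs = n \<and> set xs \<subseteq> univ M"
    and f: "f ` D = univ N" and e: "\<And>i. e i \<in> univ M"
    and dom: "form_wf L \<delta>"
      "\<And>xs. length xs = n \<Longrightarrow> set xs \<subseteq> univ M \<Longrightarrow> sat M (list_env xs e) \<delta> \<longleftrightarrow> xs \<in> D"
    and eq: "form_wf L \<epsilon>"
      "\<And>xs ys. length xs = n \<Longrightarrow> set xs \<subseteq> univ M \<Longrightarrow> length ys = n \<Longrightarrow> set ys \<subseteq> univ M \<Longrightarrow>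
        sat M (list_env (xs @ ys) e) \<epsilon> \<longleftrightarrow> xs \<in> D \<and> ys \<in> D \<and> f xs = f ys"
    and fn: "\<And>g m. fun_ar L' g = Some m \<Longrightarrow> form_wf L (\<phi> g)"
      "\<And>g m xss ys. fun_ar L' g = Some m \<Longrightarrow> length xss = m \<Longrightarrow>
        (\<And>xs. xs \<in> set (ys # xss) \<Longrightarrow> length xs = n \<and> set xs \<subseteq> univ M) \<Longrightarrow>
        sat M (list_env (concat xss @ ys) e) (\<phi> g) \<longleftrightarrow>
        set xss \<subseteq> D \<and> ys \<in> D \<and> f ys = fint N g (map f xss)"
    and rl: "\<And>r m. rel_ar L' r = Some m \<Longrightarrow> form_wf L (\<rho> r)"
      "\<And>r m xss. rel_ar L' r = Some m \<Longrightarrow> length xss = m \<Longrightarrow>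
        (\<And>xs. xs \<in> set xss \<Longrightarrow> length xs = n \<and> set xs \<subseteq> univ M) \<Longrightarrow>
        sat M (list_env (concat xss) e) (\<rho> r) \<longleftrightarrow> set xss \<subseteq> D \<and> rint N r (map f xss)"
  shows "interpretable_in L' N L M"
proof -
  \<comment> \<open>The domain is the case of one block, the kernel below that of two.\<close>
  have "definable_set L M (1 * n) {concat xss | xss. length xss = 1 \<and> set xss \<subseteq> D \<and> True}"
    by (rule definable_set_concat[where e = e, OF D dom(1) e]) (use dom(2) in \<open>auto simp: length_Suc_conv\<close>)
  moreover have "{concat xss | xss. length xss = 1 \<and> set xss \<subseteq> D \<and> True} = D"
    by (auto simp: length_Suc_conv) (metis append_Nil2 bot.extremum concat.simps insert_subset list.set list.size(3,4))
  ultimately have 1: "definable_set L M n D" by simp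
  have "definable_set L M (2 * n) {concat xss | xss. length xss = 2 \<and> set xss \<subseteq> D \<and> f (xss ! 0) = f (xss ! 1)}"
    by (rule definable_set_concat[where e = e, OF D eq(1) e])
      (use eq(2) in \<open>auto simp: length_Suc_conv numeral_2_eq_2\<close>)
  moreover have "{concat xss | xss. length xss = 2 \<and> set xss \<subseteq> D \<and> f (xss ! 0) = f (xss ! 1)} =
      {xs @ ys | xs ys. xs \<in> D \<and> ys \<in> D \<and> f xs = f ys}" (is "?A = ?B")
  proof (intro Set.set_eqI iffI)
    fix zs assume "zs \<in> ?B"
    then obtain xs ys where "zs = xs @ ys" "xs \<in> D" "ys \<in> D" "f xs = f ys" by blast
    then show "zs \<in> ?A" by (intro CollectI exI[of _ "[xs, ys]"]) simp
  qed (force simp: length_Suc_conv numeral_2_eq_2)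
  ultimately have 2: "definable_set L M (2 * n) {xs @ ys | xs ys. xs \<in> D \<and> ys \<in> D \<and> f xs = f ys}"
    by simp
  have 3: "definable_set L M ((m + 1) * n)
      {concat xss @ ys | xss ys. length xss = m \<and> set xss \<subseteq> D \<and> ys \<in> D \<and> f ys = fint N g (map f xss)}"
    if g: "fun_ar L' g = Some m" for g m
  proof -
    \<comment> \<open>The value of the function is the last of the \<open>m + 1\<close>
      blocks.\<close>
    let ?R = "\<lambda>xss. f (last xss) = fint N g (map f (butlast xss))"
    have snoc: "\<exists>yss ys. xss = yss @ [ys] \<and> length yss = m" if "length xss = m + 1" for xss :: "'a list list"
      using that by (metis Suc_eq_plus1 length_Suc_conv_rev)
    have "definable_set L M ((m + 1) * n) {concat xss | xss. length xss = m + 1 \<and> set xss \<subseteq> D \<and> ?R xss}"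
    proof (rule definable_set_concat[where e = e, OF D fn(1)[OF g] e])
      fix xss :: "'a list list" assume l: "length xss = m + 1"
        and x: "\<And>xs. xs \<in> set xss \<Longrightarrow> length xs = n \<and> set xs \<subseteq> univ M"
      obtain yss ys where y: "xss = yss @ [ys]" "length yss = m" using snoc[OF l] by blast
      show "sat M (list_env (concat xss) e) (\<phi> g) \<longleftrightarrow> set xss \<subseteq> D \<and> ?R xss"
        using fn(2)[OF g y(2), of ys] x by (simp add: y) blast
    qed
    moreover have "{concat xss | xss. length xss = m + 1 \<and> set xss \<subseteq> D \<and> ?R xss} =
      {concat xss @ ys | xss ys. length xss = m \<and> set xss \<subseteq> D \<and> ys \<in> D \<and> f ys = fint N g (map f xss)}"
      (is "?A = ?B")
    proof (intro Set.set_eqI iffI)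
      fix zs assume "zs \<in> ?A"
      then obtain xss where x: "zs = concat xss" "length xss = m + 1" "set xss \<subseteq> D" "?R xss" by blast
      moreover obtain yss ys where "xss = yss @ [ys]" "length yss = m" using snoc[OF x(2)] by blast
      ultimately show "zs \<in> ?B" by (intro CollectI exI[of _ yss] exI[of _ ys]) simp
    next
      fix zs assume "zs \<in> ?B"
      then obtain xss ys where "zs = concat xss @ ys" "length xss = m" "set xss \<subseteq> D" "ys \<in> D"
        "f ys = fint N g (map f xss)" by blast
      then show "zs \<in> ?A" by (intro CollectI exI[of _ "xss @ [ys]"]) simp
    qed
    ultimately show ?thesis by simp
  qed
  have 4: "definable_set L M (m * n) {concat xss | xss. length xss = m \<and> set xss \<subseteq> D \<and> rint N r (map f xss)}"
    if "rel_ar L' r = Some m" for r m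
    by (rule definable_set_concat[where e = e, OF D rl(1)[OF that] e])
      (assumption, rule rl(2)[OF that])
  show ?thesis
    unfolding interpretable_in_def is_interpretation_def using n f 1 2 3 4 by blast
qed

section \<open>Interpreting \<open>U(k, K)\<close> in \<open>(K, k)\<close>\<close>

abbreviation f_add (infixl "+\<^sub>f" 65) where "s +\<^sub>f t \<equiv> Fn FPlus [s, t]"
abbreviation f_mul (infixl "*\<^sub>f" 70) where "s *\<^sub>f t \<equiv> Fn FTimes [s, t]"
abbreviation f_neg where "f_neg t \<equiv> Fn FMinus [t]"

lemma field_pair_simps:
  "univ (field_pair k) = UNIV"
  "fint (field_pair k) FZero xs = 0"
  "fint (field_pair k) FOne xs = 1"
  "fint (field_pair k) FPlus xs = xs ! 0 + xs ! 1"
  "fint (field_pair k) FMinus xs = - (xs ! 0)"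
  "fint (field_pair k) FTimes xs = xs ! 0 * xs ! 1"
  "rint (field_pair k) R xs \<longleftrightarrow> xs ! 0 \<in> k"
  by (simp_all add: field_pair_def)

lemma field_pair_sig_simps:
  "fun_ar field_pair_sig FZero = Some 0"
  "fun_ar field_pair_sig FOne = Some 0"
  "fun_ar field_pair_sig FPlus = Some 2"
  "fun_ar field_pair_sig FMinus = Some 1"
  "fun_ar field_pair_sig FTimes = Some 2"
  "rel_ar field_pair_sig R = Some 1"
  by (simp_all add: field_pair_sig_def)

section \<open>Formulas about sextuples of field elements\<close>

definition tuple_at :: "(nat \<Rightarrow> 'a) \<Rightarrow> nat \<Rightarrow> 'a sextuple" where
  "tuple_at E i = (E i, E (i + 1), E (i + 2), E (i + 3), E (i + 4), E (i + 5))"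

text \<open>Coordinates 2, 4 and 6, which range over \<open>k\<close>, sit at offsets 1, 3 and
  5.\<close>

definition in_ucarrier_form :: "nat \<Rightarrow> (field_fun, subfield_rel) form" where
  "in_ucarrier_form i =
     Conj (Rel InSubfield [Var (i + 1)]) (Conj (Rel InSubfield [Var (i + 3)]) (Rel InSubfield [Var (i + 5)]))"

fun tuple_eq_form :: "field_fun trm sextuple \<Rightarrow> field_fun trm sextuple \<Rightarrow> (field_fun, subfield_rel) form" where
  "tuple_eq_form (s1, s2, s3, s4, s5, s6) (t1, t2, t3, t4, t5, t6) =
     Conj (Equal s1 t1) (Conj (Equal s2 t2) (Conj (Equal s3 t3)
       (Conj (Equal s4 t4) (Conj (Equal s5 t5) (Equal s6 t6)))))"

text \<open>This mirrors \<open>umul\<close>, with powers and differences spelled out because the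
  language has neither.\<close>

definition umul_terms :: "nat \<Rightarrow> nat \<Rightarrow> field_fun trm sextuple" where
  "umul_terms i j =
     (Var i +\<^sub>f Var j,
      Var (i + 1) +\<^sub>f Var (j + 1) +\<^sub>f Var (i + 5) *\<^sub>f (Var j *\<^sub>f Var j *\<^sub>f Var j),
      Var (i + 2) +\<^sub>f Var (j + 2) +\<^sub>f Var j *\<^sub>f Var (i + 4) +\<^sub>f f_neg (Var (i + 5) *\<^sub>f (Var j *\<^sub>f Var j)),
      Var (i + 3) +\<^sub>f Var (j + 3) +\<^sub>f (Var (i + 5) *\<^sub>f Var (i + 5)) *\<^sub>f (Var j *\<^sub>f Var j *\<^sub>f Var j) +\<^sub>f
        f_neg (Var (i + 5) *\<^sub>f Var (j + 1)),
      Var (i + 4) +\<^sub>f Var (j + 4) +\<^sub>f Var (i + 5) *\<^sub>f Var j,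
      Var (i + 5) +\<^sub>f Var (j + 5))"

definition zero_terms :: "field_fun trm sextuple" where
  "zero_terms = (Fn FZero [], Fn FZero [], Fn FZero [], Fn FZero [], Fn FZero [], Fn FZero [])"

definition var_terms :: "nat \<Rightarrow> field_fun trm sextuple" where
  "var_terms i = (Var i, Var (i + 1), Var (i + 2), Var (i + 3), Var (i + 4), Var (i + 5))"

lemma tuple_form_wf [simp]:
  "form_wf field_pair_sig (in_ucarrier_form i)"
  "form_wf field_pair_sig (tuple_eq_form (var_terms i) (umul_terms j l))"
  "form_wf field_pair_sig (tuple_eq_form (var_terms i) zero_terms)"
  "form_wf field_pair_sig (tuple_eq_form (umul_terms i j) zero_terms)"
  "form_wf field_pair_sig (tuple_eq_form (var_terms i) (var_terms j))"
  by (simp_all add: tuple_eq_form.simps in_ucarrier_form_def umul_terms_def var_terms_def zero_terms_def field_pair_sig_simps)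

lemma sat_tuple_form [simp]:
  "sat (field_pair k) E (in_ucarrier_form i) \<longleftrightarrow> tuple_at E i \<in> ucarrier k"
  "sat (field_pair k) E (tuple_eq_form (var_terms i) (umul_terms j l)) \<longleftrightarrow>
     tuple_at E i = umul (tuple_at E j) (tuple_at E l)"
  "sat (field_pair k) E (tuple_eq_form (var_terms i) zero_terms) \<longleftrightarrow> tuple_at E i = (0, 0, 0, 0, 0, 0)"
  "sat (field_pair k) E (tuple_eq_form (umul_terms i j) zero_terms) \<longleftrightarrow>
     umul (tuple_at E i) (tuple_at E j) = (0, 0, 0, 0, 0, 0)"
  "sat (field_pair k) E (tuple_eq_form (var_terms i) (var_terms j)) \<longleftrightarrow> tuple_at E i = tuple_at E j"
  by (simp_all add: tuple_eq_form.simps in_ucarrier_form_def umul_terms_def var_terms_def zero_terms_def tuple_at_def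
      power2_eq_square power3_eq_cube ucarrier_def field_pair_simps)

declare tuple_eq_form.simps [simp del]

abbreviation list_tuple :: "'a list \<Rightarrow> 'a sextuple" where
  "list_tuple xs \<equiv> tuple_at ((!) xs) 0"

lemma tuple_at_list_env:
  assumes "length xs = 6"
  shows "tuple_at (list_env xs e) 0 = list_tuple xs"
    "tuple_at (list_env (xs @ zs) e) 0 = list_tuple xs"
    "length ys = 6 \<Longrightarrow> tuple_at (list_env (ys @ xs) e) 6 = list_tuple xs"
    "length ys = 6 \<Longrightarrow> tuple_at (list_env (ys @ xs @ zs) e) 6 = list_tuple xs"
    "length ys = 6 \<Longrightarrow> length zs = 6 \<Longrightarrow> tuple_at (list_env (ys @ zs @ xs) e) 12 = list_tuple xs"
  using assms by (simp_all add: tuple_at_def list_env_def nth_append numeral_2_eq_2)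

text \<open>Arguments and value occupy successive blocks of six variables. The inverse is described
  through multiplication, as the solution \<open>y\<close> of \<open>x y = 1\<close>.\<close>

fun group_graph_form :: "group_fun \<Rightarrow> (field_fun, subfield_rel) form" where
  "group_graph_form GOne = Conj (in_ucarrier_form 0) (tuple_eq_form (var_terms 0) zero_terms)"
| "group_graph_form GInv = Conj (in_ucarrier_form 0) (Conj (in_ucarrier_form 6)
     (tuple_eq_form (umul_terms 0 6) zero_terms))"
| "group_graph_form GMult = Conj (in_ucarrier_form 0) (Conj (in_ucarrier_form 6)
     (Conj (in_ucarrier_form 12) (tuple_eq_form (var_terms 12) (umul_terms 0 6))))"

lemma group_graph_form_wf: "form_wf field_pair_sig (group_graph_form g)"
  by (cases g) simp_all

lemma rel_ar_group_sig: "rel_ar group_sig r = None"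
  by (simp add: group_sig_def)

section \<open>The interpretation of \<open>U\<close>\<close>

context subfield_cubes
begin

lemma scalar_tuple_closed: "(0, 0, c, 0, 0, 0) \<in> ucarrier k"
  by (simp add: ucarrier_def)

lemma u_elt_0: "u_elt (0, 0, 0, 0, 0, 0) = \<one>\<^bsub>UG\<^esub>"
  by (simp add: x_elt_0)

lemma u_elt_inv_iff:
  assumes "x \<in> ucarrier k" "y \<in> ucarrier k"
  shows "u_elt y = inv\<^bsub>UG\<^esub> (u_elt x) \<longleftrightarrow> umul x y = (0, 0, 0, 0, 0, 0)"
proof -
  have "u_elt y = inv\<^bsub>UG\<^esub> (u_elt x) \<longleftrightarrow> u_elt x \<otimes>\<^bsub>UG\<^esub> u_elt y = \<one>\<^bsub>UG\<^esub>"
    using assms u_elt_closed UG.inv_equality UG.r_inv UG.inv_comm by metis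
  also have "\<dots> \<longleftrightarrow> u_elt (umul x y) = u_elt (0, 0, 0, 0, 0, 0)"
    using assms by (simp only: u_elt_mult u_elt_0)
  also have "\<dots> \<longleftrightarrow> umul x y = (0, 0, 0, 0, 0, 0)"
    using assms umul_closed by (intro u_elt_eq_iff) (auto simp: ucarrier_def)
  finally show ?thesis .
qed

lemma U_group_interpretable:
  "interpretable_in group_sig (group_structure UG) field_pair_sig (field_pair k)"
\<comment> \<open>All variables of the formulas lie in the blocks, so \<open>e\<close> can be
  constant. As \<open>u_elt\<close> is injective on \<open>ucarrier k\<close>, the kernel is
  equality of tuples. Groups have no relation symbols, so \<open>\<rho>\<close> can be
  \<open>undefined\<close>.\<close>
proof (rule interpretable_inI[where n = 6 and e = "\<lambda>_. 0" and D = "{xs. length xs = 6 \<and> list_tuple xs \<in> ucarrier k}"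
      and f = "\<lambda>xs. u_elt (list_tuple xs)" and \<delta> = "in_ucarrier_form 0"
      and \<epsilon> = "Conj (in_ucarrier_form 0) (Conj (in_ucarrier_form 6) (tuple_eq_form (var_terms 0) (var_terms 6)))"
      and \<phi> = group_graph_form and \<rho> = undefined])
  show "(\<lambda>xs. u_elt (list_tuple xs)) ` {xs. length xs = 6 \<and> list_tuple xs \<in> ucarrier k} = univ (group_structure UG)"
  proof -
    have "\<exists>xs. length xs = 6 \<and> list_tuple xs = x" for x :: "'a sextuple"
      by (cases x) (rule exI[of _ "[fst x, fst (snd x), fst (snd (snd x)), fst (snd (snd (snd x))),
          fst (snd (snd (snd (snd x)))), snd (snd (snd (snd (snd x))))]"], simp add: tuple_at_def)
    then have "x \<in> list_tuple ` {xs. length xs = 6 \<and> list_tuple xs \<in> ucarrier k}"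
      if "x \<in> ucarrier k" for x :: "'a sextuple"
      using that by (metis (mono_tags, lifting) image_eqI mem_Collect_eq)
    then have "list_tuple ` {xs. length xs = 6 \<and> list_tuple xs \<in> ucarrier k} = ucarrier k"
      by (intro subset_antisym subsetI) (auto simp only: mem_Collect_eq)
    then show ?thesis
      unfolding image_image[of u_elt list_tuple, symmetric]
      by (simp only: group_structure_def fo_structure.simps u_elt_image)
  qed
next
  fix xs ys :: "'a list"
  assume "length xs = 6" "length ys = 6"
  then show "sat (field_pair k) (list_env (xs @ ys) (\<lambda>_. 0))
      (Conj (in_ucarrier_form 0) (Conj (in_ucarrier_form 6) (tuple_eq_form (var_terms 0) (var_terms 6)))) \<longleftrightarrow>
    xs \<in> {xs. length xs = 6 \<and> list_tuple xs \<in> ucarrier k} \<and>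
    ys \<in> {xs. length xs = 6 \<and> list_tuple xs \<in> ucarrier k} \<and> u_elt (list_tuple xs) = u_elt (list_tuple ys)"
    by (simp add: tuple_at_list_env u_elt_eq_iff conj_ac cong: conj_cong)
next
  fix g m and xss :: "'a list list" and ys
  assume g: "fun_ar group_sig g = Some m" and m: "length xss = m"
    and l: "\<And>xs. xs \<in> set (ys # xss) \<Longrightarrow> length xs = 6 \<and> set xs \<subseteq> univ (field_pair k)"
  then show "sat (field_pair k) (list_env (concat xss @ ys) (\<lambda>_. 0)) (group_graph_form g) \<longleftrightarrow>
    set xss \<subseteq> {xs. length xs = 6 \<and> list_tuple xs \<in> ucarrier k} \<and>
    ys \<in> {xs. length xs = 6 \<and> list_tuple xs \<in> ucarrier k} \<and>
    u_elt (list_tuple ys) = fint (group_structure UG) g (map (\<lambda>xs. u_elt (list_tuple xs)) xss)"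
  proof (cases g)
    case GOne
    then have "xss = []" using g m by (simp add: group_sig_def)
    then show ?thesis
      using l u_elt_eq_iff[of "list_tuple ys" "(0, 0, 0, 0, 0, 0)"]
      by (simp add: GOne group_structure_def tuple_at_list_env scalar_tuple_closed flip: u_elt_0
          del: u_elt.simps cong: conj_cong)
  next
    case GInv
    then have "length xss = 1" using g m by (simp add: group_sig_def)
    then obtain xs where "xss = [xs]" by (auto simp: length_Suc_conv)
    then show ?thesis
      using l
      by (simp add: GInv group_structure_def tuple_at_list_env u_elt_inv_iff cong: conj_cong)
  next
    case GMult
    then have "length xss = 2" using g m by (simp add: group_sig_def)
    then obtain xs zs where "xss = [xs, zs]" by (auto simp: length_Suc_conv numeral_2_eq_2)
    then show ?thesis
      using l
      by (simp add: GMult group_structure_def tuple_at_list_env u_elt_mult u_elt_eq_iff umul_closed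
          cong: conj_cong)
  qed
qed (simp_all add: tuple_at_list_env field_pair_simps group_graph_form_wf rel_ar_group_sig)

end

section \<open>Interpreting \<open>(K, k)\<close> in \<open>U(k, K)\<close>\<close>

lemma group_structure_simps:
  "univ (group_structure G) = carrier G"
  "fint (group_structure G) GMult xs = xs ! 0 \<otimes>\<^bsub>G\<^esub> xs ! 1"
  "fun_ar group_sig GMult = Some 2"
  by (simp_all add: group_structure_def group_sig_def)

abbreviation g_mul (infixl "*\<^sub>g" 70) where "s *\<^sub>g t \<equiv> Fn GMult [s, t]"

text \<open>\<open>[u, v] = w\<close> is expressed as \<open>u v = v u w\<close>.\<close>

definition commutator_form :: "nat \<Rightarrow> nat \<Rightarrow> nat \<Rightarrow> (group_fun, unit) form" where
  "commutator_form i j l = Equal (Var i *\<^sub>g Var j) (Var j *\<^sub>g Var i *\<^sub>g Var l)"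

definition commute_form :: "nat \<Rightarrow> nat \<Rightarrow> (group_fun, unit) form" where
  "commute_form i j = Equal (Var i *\<^sub>g Var j) (Var j *\<^sub>g Var i)"

text \<open>The variables \<open>10\<close>, \<open>11\<close>, \<open>12\<close> stand for the parameters \<open>p = x\<^sub>1(1)\<close>, \<open>q = x\<^sub>2(1) x\<^sub>5(1)\<close> and
  \<open>r = x\<^sub>6(1)\<close>, with centralizers \<open>U\<^sub>1U\<^sub>2U\<^sub>3U\<^sub>4\<close>, \<open>U\<^sub>2U\<^sub>3U\<^sub>4U\<^sub>5\<close> and \<open>U\<^sub>3U\<^sub>4U\<^sub>5U\<^sub>6\<close>.\<close>

definition scalar_form :: "nat \<Rightarrow> (group_fun, unit) form" where
  "scalar_form i = Exist 13 (Conj (commute_form 13 10) (commutator_form 13 11 i))"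

text \<open>The last free variable below 10 holds the value. Zero is the idempotent, and the
  negative of \<open>x\<close> is the \<open>y\<close> with \<open>x y x = x\<close>, so terms need
  multiplication only. Bound variables start at 13, after the parameters.\<close>

fun field_graph_form :: "field_fun \<Rightarrow> (group_fun, unit) form" where
  "field_graph_form FZero = Conj (scalar_form 0) (Equal (Var 0 *\<^sub>g Var 0) (Var 0))"
| "field_graph_form FOne = Conj (scalar_form 0) (commutator_form 10 11 0)"
| "field_graph_form FPlus = Conj (scalar_form 0) (Conj (scalar_form 1) (Conj (scalar_form 2)
     (Equal (Var 0 *\<^sub>g Var 1) (Var 2))))"
| "field_graph_form FMinus = Conj (scalar_form 0) (Conj (scalar_form 1)
     (Equal (Var 0 *\<^sub>g Var 1 *\<^sub>g Var 0) (Var 0)))"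
| "field_graph_form FTimes = Conj (scalar_form 0) (Conj (scalar_form 1) (Conj (scalar_form 2)
     (Exist 13 (Exist 14 (Conj (commute_form 13 10) (Conj (commute_form 14 11)
       (Conj (commutator_form 13 11 0) (Conj (commutator_form 10 14 1) (commutator_form 13 14 2)))))))))"

text \<open>Variable 14 holds the inner commutator \<open>[p, g]\<close>.\<close>

definition subfield_form :: "(group_fun, unit) form" where
  "subfield_form = Conj (scalar_form 0) (Exist 13 (Exist 14
     (Conj (commute_form 13 12) (Conj (commutator_form 10 13 14) (commutator_form 10 14 0)))))"

section \<open>Commutators with the parameters, in coordinates\<close>

context subfield_cubes
begin

abbreviation "p_tuple \<equiv> (1, 0, 0, 0, 0, 0) :: 'a sextuple"
abbreviation "q_tuple \<equiv> (0, 1, 0, 0, 1, 0) :: 'a sextuple"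
abbreviation "r_tuple \<equiv> (0, 0, 0, 0, 0, 1) :: 'a sextuple"

abbreviation "params \<equiv> (\<lambda>i::nat. if i = 10 then p_tuple else if i = 11 then q_tuple else
  if i = 12 then r_tuple else (0, 0, 0, 0, 0, 0))"

lemma bex_carrier_UG: "(\<exists>g\<in>carrier UG. P g) \<longleftrightarrow> (\<exists>s\<in>ucarrier k. P (u_elt s))"
  unfolding u_elt_image[symmetric] by blast

text \<open>Truth in \<open>U\<close> read in coordinates: quantifiers range over
  \<open>ucarrier k\<close>, and group equations become equations for \<open>umul\<close>.\<close>

definition tuple_sat :: "(nat \<Rightarrow> 'a sextuple) \<Rightarrow> (group_fun, unit) form \<Rightarrow> bool" where
  "tuple_sat T \<phi> = sat (group_structure UG) (\<lambda>i. u_elt (T i)) \<phi>"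

lemma tuple_sat_simps:
  "tuple_sat T (Conj \<phi> \<psi>) \<longleftrightarrow> tuple_sat T \<phi> \<and> tuple_sat T \<psi>"
  "tuple_sat T (Exist i \<phi>) \<longleftrightarrow> (\<exists>s\<in>ucarrier k. tuple_sat (T(i := s)) \<phi>)"
proof -
  have "(\<lambda>j. u_elt (T j))(i := u_elt s) = (\<lambda>j. u_elt ((T(i := s)) j))" for s
    by (simp add: fun_eq_iff)
  then show "tuple_sat T (Exist i \<phi>) \<longleftrightarrow> (\<exists>s\<in>ucarrier k. tuple_sat (T(i := s)) \<phi>)"
    by (simp add: tuple_sat_def group_structure_simps bex_carrier_UG)
qed (simp add: tuple_sat_def)

lemma tuple_sat_equation:
  assumes "\<And>i. T i \<in> ucarrier k"
  shows
    "tuple_sat T (commutator_form i j l) \<longleftrightarrow> umul (T i) (T j) = umul (umul (T j) (T i)) (T l)"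
    "tuple_sat T (commute_form i j) \<longleftrightarrow> umul (T i) (T j) = umul (T j) (T i)"
    "tuple_sat T (Equal (Var i *\<^sub>g Var j) (Var l)) \<longleftrightarrow> umul (T i) (T j) = T l"
    "tuple_sat T (Equal (Var i *\<^sub>g Var j *\<^sub>g Var l) (Var m)) \<longleftrightarrow> umul (umul (T i) (T j)) (T l) = T m"
    "tuple_sat T (Equal (Var i) (Var j)) \<longleftrightarrow> T i = T j"
  using assms by (simp_all add: tuple_sat_def commutator_form_def commute_form_def
      group_structure_simps u_elt_mult u_elt_eq_iff umul_closed)

text \<open>In \<open>C(p)\<close>, which is \<open>U\<^sub>1U\<^sub>2U\<^sub>3U\<^sub>4\<close>,
  only the factor \<open>x\<^sub>1(a)\<close> of \<open>g\<close> fails to commute with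
  \<open>q\<close>, so \<open>[g, q] = x\<^sub>3(-a)\<close>. The bound on \<open>i\<close> keeps it
  apart from parameters and bound variables.\<close>

lemma tuple_sat_scalar_form:
  assumes T: "\<And>i. T i \<in> ucarrier k" and "T 10 = p_tuple" "T 11 = q_tuple" "i < 10"
  shows "tuple_sat T (scalar_form i) \<longleftrightarrow> (\<exists>c. T i = (0, 0, - c, 0, 0, 0))"
proof -
  have "tuple_sat T (scalar_form i) \<longleftrightarrow>
    (\<exists>s\<in>ucarrier k. umul s p_tuple = umul p_tuple s \<and> umul s q_tuple = umul (umul q_tuple s) (T i))"
    using assms by (simp add: scalar_form_def tuple_sat_simps tuple_sat_equation cong: bex_cong del: umul.simps)
  also have "\<dots> \<longleftrightarrow> (\<exists>c. T i = (0, 0, - c, 0, 0, 0))"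
  proof (intro iffI)
    assume "\<exists>c. T i = (0, 0, - c, 0, 0, 0)"
    then obtain c where c: "T i = (0, 0, - c, 0, 0, 0)" by blast
    \<comment> \<open>The witness is \<open>x\<^sub>1(c)\<close>: it commutes with
      \<open>x\<^sub>2(1)\<close>, and its commutator with \<open>x\<^sub>5(1)\<close> is
      \<open>x\<^sub>3(-c)\<close>.\<close>
    show "\<exists>s\<in>ucarrier k. umul s p_tuple = umul p_tuple s \<and> umul s q_tuple = umul (umul q_tuple s) (T i)"
      by (rule bexI[of _ "(c, 0, 0, 0, 0, 0)"]) (simp_all add: c ucarrier_def)
  next
    assume "\<exists>s\<in>ucarrier k. umul s p_tuple = umul p_tuple s \<and> umul s q_tuple = umul (umul q_tuple s) (T i)"
    then obtain s where s: "umul s p_tuple = umul p_tuple s" "umul s q_tuple = umul (umul q_tuple s) (T i)"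
      by blast
    obtain a1 a2 a3 a4 a5 a6 where a: "s = (a1, a2, a3, a4, a5, a6)" by (cases s)
    obtain t1 t2 t3 t4 t5 t6 where t: "T i = (t1, t2, t3, t4, t5, t6)" by (cases "T i")
    have 0: "a6 = 0" "a5 = 0" using s(1) by (auto simp: a)
    have "t1 = 0" "t6 = 0" "t5 = 0" using s(2) by (auto simp: a t 0)
    moreover have "t2 = 0" "t4 = 0" using s(2) calculation by (auto simp: a t 0 algebra_simps)
    ultimately have "T i = (0, 0, - (- t3), 0, 0, 0)" by (simp add: t)
    then show "\<exists>c. T i = (0, 0, - c, 0, 0, 0)" by blast
  qed
  finally show ?thesis .
qed

text \<open>The relation \<open>[x\<^sub>1(a), x\<^sub>5(b)] = x\<^sub>3(-ab)\<close> encodes the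
  product. The conditions fix the \<open>U\<^sub>1\<close> part of \<open>s\<close> and the
  \<open>U\<^sub>5\<close> part of \<open>h\<close>; what remains free lies in
  \<open>U\<^sub>2U\<^sub>3U\<^sub>4\<close>, which is abelian and commutes with
  \<open>U\<^sub>1\<close> and \<open>U\<^sub>5\<close>.\<close>

lemma times_witnesses_iff:
  "(\<exists>s\<in>ucarrier k. \<exists>h\<in>ucarrier k. umul s p_tuple = umul p_tuple s \<and> umul h q_tuple = umul q_tuple h \<and>
     umul s q_tuple = umul (umul q_tuple s) (0, 0, - a, 0, 0, 0) \<and>
     umul p_tuple h = umul (umul h p_tuple) (0, 0, - b, 0, 0, 0) \<and>
     umul s h = umul (umul h s) (0, 0, - c, 0, 0, 0)) \<longleftrightarrow> c = a * b" (is "?L \<longleftrightarrow> _")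
proof
  assume "c = a * b"
  then show ?L
    by - (rule bexI[of _ "(a, 0, 0, 0, 0, 0)"], rule bexI[of _ "(0, 0, 0, 0, b, 0)"],
      simp_all add: ucarrier_def)
next
  assume ?L
  then obtain s h where sh: "umul s p_tuple = umul p_tuple s" "umul h q_tuple = umul q_tuple h"
     "umul s q_tuple = umul (umul q_tuple s) (0, 0, - a, 0, 0, 0)"
     "umul p_tuple h = umul (umul h p_tuple) (0, 0, - b, 0, 0, 0)"
     "umul s h = umul (umul h s) (0, 0, - c, 0, 0, 0)" by blast
  obtain a1 a2 a3 a4 a5 a6 where a: "s = (a1, a2, a3, a4, a5, a6)" by (cases s)
  obtain b1 b2 b3 b4 b5 b6 where b: "h = (b1, b2, b3, b4, b5, b6)" by (cases h)
  have 0: "a6 = 0" "a5 = 0" using sh(1) by (auto simp: a)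
  \<comment> \<open>A factor from \<open>U\<^sub>6\<close> in \<open>h\<close> would give
    \<open>[p, h]\<close> a component in \<open>U\<^sub>2\<close>.\<close>
  have "b6 = 0" using sh(4) by (auto simp: b)
  moreover have "b1 = 0" using sh(2) by (auto simp: b)
  moreover have "a1 = a" using sh(3) by (auto simp: a 0 algebra_simps)
  ultimately show "c = a * b" using sh(4,5) by (auto simp: a b 0 algebra_simps)
qed

text \<open>The exponent of \<open>x\<^sub>6\<close> ranges over \<open>k\<close>. The commutator
  with \<open>p\<close> carries it, up to sign, to \<open>U\<^sub>5\<close>, and a second one
  carries it to \<open>U\<^sub>3\<close>, where the scalars live.\<close>

lemma subfield_witnesses_iff:
  "(\<exists>s\<in>ucarrier k. \<exists>h\<in>ucarrier k. umul s r_tuple = umul r_tuple s \<and>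
     umul p_tuple s = umul (umul s p_tuple) h \<and>
     umul p_tuple h = umul (umul h p_tuple) (0, 0, - c, 0, 0, 0)) \<longleftrightarrow> c \<in> k" (is "?L \<longleftrightarrow> _")
proof
  assume "c \<in> k"
  moreover from this have "2 * (c * c) \<in> k"
    using k_closed(3)[of "c * c" "c * c"] by (simp only: mult_2 k_closed)
  \<comment> \<open>The witnesses are \<open>x\<^sub>6(-c)\<close> and
    \<open>[p, x\<^sub>6(-c)]\<close>. The fourth exponent \<open>c ^ 2\<close> is written as
    \<open>- (c ^ 2) - c ^ 2\<close>, so that the equations hold without reduction modulo
    three.\<close>
  ultimately show ?L
    by - (rule bexI[of _ "(0, 0, 0, 0, 0, - c)"], rule bexI[of _ "(0, c, - c, - (c ^ 2) - c ^ 2, c, 0)"],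
      simp_all add: ucarrier_def power2_eq_square)
next
  assume ?L
  then obtain s h where sh: "s \<in> ucarrier k" "umul s r_tuple = umul r_tuple s"
     "umul p_tuple s = umul (umul s p_tuple) h"
     "umul p_tuple h = umul (umul h p_tuple) (0, 0, - c, 0, 0, 0)" by blast
  obtain a1 a2 a3 a4 a5 a6 where a: "s = (a1, a2, a3, a4, a5, a6)" by (cases s)
  obtain b1 b2 b3 b4 b5 b6 where b: "h = (b1, b2, b3, b4, b5, b6)" by (cases h)
  have 0: "a1 = 0" using sh(2) by (auto simp: a)
  have 1: "b1 = 0" "b6 = 0" using sh(3) by (auto simp: a b 0)
  have "a5 = a5 + a6 + b5" using sh(3) by (simp add: a b 0 1)
  \<comment> \<open>The commutator \<open>[p, s]\<close> has as fifth exponent the negative of the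
    sixth exponent of \<open>s\<close>, which lies in \<open>k\<close>.\<close>
  then have "b5 = - a6" by (simp add: eq_neg_iff_add_eq_0 add.commute add.assoc)
  moreover have "c = b5" using sh(4) by (auto simp: b 1 algebra_simps)
  moreover have "a6 \<in> k" using sh(1) by (simp add: a ucarrier_def)
  ultimately show "c \<in> k" by simp
qed

text \<open>The sign absorbs the one in
  \<open>[x\<^sub>1(a), x\<^sub>5(b)] = x\<^sub>3(-ab)\<close>, so that commutators represent
  products without a sign.\<close>

definition scalar_tuple :: "'a \<Rightarrow> 'a sextuple" where
  "scalar_tuple c = (0, 0, - c, 0, 0, 0)"

lemma scalar_tuple_eq_iff: "scalar_tuple a = scalar_tuple b \<longleftrightarrow> a = b"
  by (simp add: scalar_tuple_def)

definition scalar_elt :: "'a \<Rightarrow> (nat \<times> 'a) gword set" where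
  "scalar_elt c = u_elt (scalar_tuple c)"

lemma inj_scalar_elt: "inj scalar_elt"
  by (rule injI) (simp add: scalar_elt_def scalar_tuple_def u_elt_eq_iff scalar_tuple_closed del: u_elt.simps)

lemma params_closed: "params i \<in> ucarrier k"
  by (simp add: ucarrier_def)

lemma tuple_sat_times_form:
  assumes T: "\<And>i. T i \<in> ucarrier k" and "T 10 = p_tuple" "T 11 = q_tuple"
    "T 0 = (0, 0, - a, 0, 0, 0)" "T 1 = (0, 0, - b, 0, 0, 0)" "T 2 = (0, 0, - c, 0, 0, 0)"
  shows "tuple_sat T (field_graph_form FTimes) \<longleftrightarrow> c = a * b"
proof -
  have "tuple_sat T (scalar_form i)" if "i = 0 \<or> i = 1 \<or> i = 2" for i
    using assms that by (subst tuple_sat_scalar_form) auto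
  then have "tuple_sat T (field_graph_form FTimes) \<longleftrightarrow>
    (\<exists>s\<in>ucarrier k. \<exists>h\<in>ucarrier k. umul s p_tuple = umul p_tuple s \<and> umul h q_tuple = umul q_tuple h \<and>
      umul s q_tuple = umul (umul q_tuple s) (0, 0, - a, 0, 0, 0) \<and>
      umul p_tuple h = umul (umul h p_tuple) (0, 0, - b, 0, 0, 0) \<and>
      umul s h = umul (umul h s) (0, 0, - c, 0, 0, 0))"
    using assms by (simp add: tuple_sat_simps tuple_sat_equation cong: bex_cong del: umul.simps One_nat_def)
  then show ?thesis by (simp only: times_witnesses_iff)
qed

lemma tuple_sat_subfield_form:
  assumes T: "\<And>i. T i \<in> ucarrier k" and "T 10 = p_tuple" "T 11 = q_tuple" "T 12 = r_tuple"
    "T 0 = (0, 0, - c, 0, 0, 0)"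
  shows "tuple_sat T subfield_form \<longleftrightarrow> c \<in> k"
proof -
  have "tuple_sat T (scalar_form 0)"
    using assms by (subst tuple_sat_scalar_form) auto
  then have "tuple_sat T subfield_form \<longleftrightarrow>
    (\<exists>s\<in>ucarrier k. \<exists>h\<in>ucarrier k. umul s r_tuple = umul r_tuple s \<and>
     umul p_tuple s = umul (umul s p_tuple) h \<and>
     umul p_tuple h = umul (umul h p_tuple) (0, 0, - c, 0, 0, 0))"
    using assms by (simp add: subfield_form_def tuple_sat_simps tuple_sat_equation cong: bex_cong del: umul.simps)
  then show ?thesis by (simp only: subfield_witnesses_iff)
qed

lemma tuple_sat_field_forms:
  assumes T: "\<And>i. T i \<in> ucarrier k" and pqr: "T 10 = p_tuple" "T 11 = q_tuple" "T 12 = r_tuple"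
  shows
    "tuple_sat T (field_graph_form FZero) \<longleftrightarrow> T 0 = scalar_tuple 0"
    "tuple_sat T (field_graph_form FOne) \<longleftrightarrow> T 0 = scalar_tuple 1"
    "tuple_sat T (field_graph_form FPlus) \<longleftrightarrow>
      (\<exists>a b. T 0 = scalar_tuple a \<and> T 1 = scalar_tuple b \<and> T 2 = scalar_tuple (a + b))"
    "tuple_sat T (field_graph_form FMinus) \<longleftrightarrow> (\<exists>a. T 0 = scalar_tuple a \<and> T 1 = scalar_tuple (- a))"
    "tuple_sat T (field_graph_form FTimes) \<longleftrightarrow>
      (\<exists>a b. T 0 = scalar_tuple a \<and> T 1 = scalar_tuple b \<and> T 2 = scalar_tuple (a * b))"
    "tuple_sat T subfield_form \<longleftrightarrow> (\<exists>c\<in>k. T 0 = scalar_tuple c)"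
proof -
  have scalar: "tuple_sat T (scalar_form i) \<longleftrightarrow> (\<exists>c. T i = scalar_tuple c)" if "i < 10" for i
    using tuple_sat_scalar_form[of T i] assms that by (simp add: scalar_tuple_def)
  \<comment> \<open>Idempotence of \<open>x\<^sub>3(-c)\<close> amounts to \<open>2 * c = c\<close>,
    which then forces \<open>c = 0\<close>.\<close>
  have "(2::'a) \<noteq> 1" by (metis add_cancel_right_right one_add_one zero_neq_one)
  then show "tuple_sat T (field_graph_form FZero) \<longleftrightarrow> T 0 = scalar_tuple 0"
    using T by (auto simp: tuple_sat_simps tuple_sat_equation scalar scalar_tuple_def)
  show "tuple_sat T (field_graph_form FOne) \<longleftrightarrow> T 0 = scalar_tuple 1"
    using T pqr by (auto simp: tuple_sat_simps tuple_sat_equation scalar scalar_tuple_def)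
  have neg: "\<exists>c. z = - c" for z :: 'a by (metis minus_minus)
  then show "tuple_sat T (field_graph_form FPlus) \<longleftrightarrow>
      (\<exists>a b. T 0 = scalar_tuple a \<and> T 1 = scalar_tuple b \<and> T 2 = scalar_tuple (a + b))"
    using T by (auto simp: tuple_sat_simps tuple_sat_equation scalar scalar_tuple_def)
  show "tuple_sat T (field_graph_form FMinus) \<longleftrightarrow> (\<exists>a. T 0 = scalar_tuple a \<and> T 1 = scalar_tuple (- a))"
    using T by (auto simp: tuple_sat_simps tuple_sat_equation scalar scalar_tuple_def add_eq_0_iff neg)
  show "tuple_sat T (field_graph_form FTimes) \<longleftrightarrow>
      (\<exists>a b. T 0 = scalar_tuple a \<and> T 1 = scalar_tuple b \<and> T 2 = scalar_tuple (a * b))"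
  \<comment> \<open>If one of the three variables is not a scalar, both sides fail.\<close>
  proof (cases "\<exists>a b c. T 0 = scalar_tuple a \<and> T 1 = scalar_tuple b \<and> T 2 = scalar_tuple c")
    case True
    then obtain a b c where "T 0 = scalar_tuple a" "T 1 = scalar_tuple b" "T 2 = scalar_tuple c" by blast
    then show ?thesis
      using tuple_sat_times_form[of T a b c] assms
      by (simp add: scalar_tuple_def del: field_graph_form.simps One_nat_def)
  qed (auto simp: tuple_sat_simps scalar)
  show "tuple_sat T subfield_form \<longleftrightarrow> (\<exists>c\<in>k. T 0 = scalar_tuple c)"
  proof (cases "\<exists>c. T 0 = scalar_tuple c")
    case True
    then obtain c where "T 0 = scalar_tuple c" by blast
    then show ?thesis
      using tuple_sat_subfield_form[of T c] assms by (auto simp: scalar_tuple_def)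
  qed (auto simp: tuple_sat_simps scalar subfield_form_def)
qed

section \<open>Assembling the interpretation of \<open>(K, k)\<close>\<close>

lemma field_graph_form_wf:
  "form_wf group_sig (scalar_form i)" "form_wf group_sig (field_graph_form g)"
  "form_wf group_sig subfield_form"
proof -
  show s: "form_wf group_sig (scalar_form i)" for i
    by (simp add: scalar_form_def commutator_form_def commute_form_def group_structure_simps)
  show "form_wf group_sig (field_graph_form g)" "form_wf group_sig subfield_form"
    using s by (cases g; simp add: subfield_form_def commutator_form_def commute_form_def group_structure_simps)+
qed

lemma field_pair_interpretable:
  "interpretable_in field_pair_sig (field_pair k) group_sig (group_structure UG)"
proof -
  let ?M = "group_structure UG"
  \<comment> \<open>The interpretation is one-dimensional with domain \<open>U\<^sub>3\<close>, and
    its coordinate map inverts the injection \<open>scalar_elt\<close>.\<close>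
  let ?D = "range (\<lambda>c. [scalar_elt c])" and ?f = "\<lambda>xs. the_inv scalar_elt (hd xs)"
    and ?e = "\<lambda>i. u_elt (params i)"
  have f: "the_inv scalar_elt (u_elt (scalar_tuple c)) = c" for c
    using the_inv_f_f[OF inj_scalar_elt, of c] by (simp add: scalar_elt_def)
  have single: "\<exists>s\<in>ucarrier k. xs = [u_elt s]" if "length xs = 1 \<and> set xs \<subseteq> univ ?M" for xs
    using that by (auto simp: length_Suc_conv group_structure_simps u_elt_image[symmetric])
  \<comment> \<open>Formulas are transferred from elements of \<open>U\<close> to sextuples, where
    \<open>tuple_sat_field_forms\<close> applies.\<close>
  have env: "sat ?M (list_env (map u_elt ss) ?e) \<phi> \<longleftrightarrow> tuple_sat (list_env ss params) \<phi>" for ss \<phi>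
  proof -
    have "list_env (map u_elt ss) ?e = (\<lambda>i. u_elt (list_env ss params i))"
      by (rule ext) (simp add: list_env_def)
    then show ?thesis by (simp add: tuple_sat_def)
  qed
  have D: "[u_elt s] \<in> ?D \<longleftrightarrow> (\<exists>c. s = scalar_tuple c)" if "s \<in> ucarrier k" for s
    using that by (auto simp: scalar_elt_def u_elt_eq_iff scalar_tuple_closed scalar_tuple_def
        simp del: u_elt.simps)
  \<comment> \<open>Tuples of length at most ten leave the parameters at 10, 11 and 12 in
    place.\<close>
  have T: "list_env ss params i \<in> ucarrier k" "list_env ss params 10 = p_tuple"
    "list_env ss params 11 = q_tuple" "list_env ss params 12 = r_tuple"
    if "set ss \<subseteq> ucarrier k" "length ss \<le> 10" for ss i
    using that params_closed by (auto simp: list_env_def)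
  have scalar: "tuple_sat (list_env ss params) (scalar_form i) \<longleftrightarrow> [u_elt (ss ! i)] \<in> ?D"
    if "set ss \<subseteq> ucarrier k" "length ss \<le> 10" "i < length ss" for ss i
  proof -
    have "ss ! i \<in> ucarrier k" using that by (meson nth_mem subsetD)
    then show ?thesis
      using tuple_sat_scalar_form[of "list_env ss params" i] T[OF that(1,2)] that(2,3)
      by (simp add: D list_env_def[of ss params i] scalar_tuple_def)
  qed
  show ?thesis
  proof (rule interpretable_inI[where n = 1 and e = ?e and D = ?D and f = ?f and \<delta> = "scalar_form 0"
      and \<epsilon> = "Conj (scalar_form 0) (Conj (scalar_form 1) (Equal (Var 0) (Var 1)))"
      and \<phi> = field_graph_form and \<rho> = "\<lambda>_. subfield_form"])
    show "?f ` ?D = univ (field_pair k)"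
      by (auto simp: field_pair_simps image_image scalar_elt_def f)
    show "?e i \<in> univ ?M" for i
      unfolding group_structure_simps by (intro u_elt_closed params_closed)
    show "length xs = 1 \<and> set xs \<subseteq> univ ?M" if "xs \<in> ?D" for xs
      using that u_elt_closed scalar_tuple_closed
      by (auto simp: group_structure_simps scalar_elt_def scalar_tuple_def simp del: u_elt.simps)
    fix xs assume "length xs = 1" "set xs \<subseteq> univ ?M"
    then obtain s where s: "s \<in> ucarrier k" "xs = [u_elt s]" using single by blast
    then show "sat ?M (list_env xs ?e) (scalar_form 0) \<longleftrightarrow> xs \<in> ?D"
      using env[of "[s]"] scalar[of "[s]" 0] by simp
    fix ys assume "length ys = 1" "set ys \<subseteq> univ ?M"
    then obtain t where t: "t \<in> ucarrier k" "ys = [u_elt t]" using single by blast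
    have "sat ?M (list_env (xs @ ys) ?e) (Conj (scalar_form 0) (Conj (scalar_form 1) (Equal (Var 0) (Var 1))))
      \<longleftrightarrow> xs \<in> ?D \<and> ys \<in> ?D \<and> s = t"
      using env[of "[s, t]"] scalar[of "[s, t]" 0] scalar[of "[s, t]" 1] T[of "[s, t]"] s t
      by (simp add: tuple_sat_simps tuple_sat_equation) (simp add: list_env_def u_elt_eq_iff)
    also have "\<dots> \<longleftrightarrow> xs \<in> ?D \<and> ys \<in> ?D \<and> ?f xs = ?f ys"
      using s t by (auto simp: D f)
    finally show "sat ?M (list_env (xs @ ys) ?e)
        (Conj (scalar_form 0) (Conj (scalar_form 1) (Equal (Var 0) (Var 1)))) \<longleftrightarrow>
      xs \<in> ?D \<and> ys \<in> ?D \<and> ?f xs = ?f ys" .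
  next
    fix g m xss ys
    assume g: "fun_ar field_pair_sig g = Some m" and m: "length xss = m"
      and l: "\<And>xs. xs \<in> set (ys # xss) \<Longrightarrow> length xs = 1 \<and> set xs \<subseteq> univ ?M"
    obtain t where t: "t \<in> ucarrier k" "ys = [u_elt t]" using single l by (meson list.set_intros(1))
    have ex: "\<exists>s\<in>ucarrier k. xs = [u_elt s]" if "xs \<in> set xss" for xs
      using single l that by (meson list.set_intros(2))
    have pair: "\<exists>r\<in>ucarrier k. \<exists>s\<in>ucarrier k. xss = [[u_elt r], [u_elt s]]" if "m = 2"
    proof -
      from m that obtain xs zs where x: "xss = [xs, zs]" by (auto simp: length_Suc_conv numeral_2_eq_2)
      show ?thesis using ex[of xs] ex[of zs] x by auto
    qed
    show "sat ?M (list_env (concat xss @ ys) ?e) (field_graph_form g) \<longleftrightarrow>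
      set xss \<subseteq> ?D \<and> ys \<in> ?D \<and> ?f ys = fint (field_pair k) g (map ?f xss)"
    proof (cases g)
      case FZero
      have "tuple_sat (list_env [t] params) (field_graph_form g) \<longleftrightarrow> t = scalar_tuple 0"
        unfolding FZero by (subst tuple_sat_field_forms[OF T]) (use t in \<open>simp_all add: list_env_def\<close>)
      then show ?thesis
        using g m t env[of "[t]"] by (auto simp: FZero field_pair_sig_simps D f field_pair_simps
            simp del: field_graph_form.simps)
    next
      case FOne
      have "tuple_sat (list_env [t] params) (field_graph_form g) \<longleftrightarrow> t = scalar_tuple 1"
        unfolding FOne by (subst tuple_sat_field_forms[OF T]) (use t in \<open>simp_all add: list_env_def\<close>)
      then show ?thesis
        using g m t env[of "[t]"] by (auto simp: FOne field_pair_sig_simps D f field_pair_simps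
            simp del: field_graph_form.simps)
    next
      case FMinus
      then obtain s where s: "s \<in> ucarrier k" "xss = [[u_elt s]]"
        using ex g m by (auto simp: length_Suc_conv field_pair_sig_simps)
      have "tuple_sat (list_env [s, t] params) (field_graph_form g) \<longleftrightarrow>
          (\<exists>a. s = scalar_tuple a \<and> t = scalar_tuple (- a))"
        unfolding FMinus by (subst tuple_sat_field_forms[OF T]) (use s t in \<open>simp_all add: list_env_def\<close>)
      also have "\<dots> \<longleftrightarrow> (\<exists>a. s = scalar_tuple a) \<and> (\<exists>a. t = scalar_tuple a) \<and>
          ?f [u_elt t] = - ?f [u_elt s]"
        by (auto simp: f scalar_tuple_eq_iff)
      finally show ?thesis
        using s t env[of "[s, t]"] by (simp add: FMinus D field_pair_simps del: field_graph_form.simps)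
    next
      case FPlus
      then obtain r s where s: "r \<in> ucarrier k" "s \<in> ucarrier k" "xss = [[u_elt r], [u_elt s]]"
        using pair g by (simp add: field_pair_sig_simps) blast
      have "tuple_sat (list_env [r, s, t] params) (field_graph_form g) \<longleftrightarrow>
          (\<exists>a b. r = scalar_tuple a \<and> s = scalar_tuple b \<and> t = scalar_tuple (a + b))"
        unfolding FPlus by (subst tuple_sat_field_forms[OF T]) (use s t in \<open>simp_all add: list_env_def\<close>)
      also have "\<dots> \<longleftrightarrow> (\<exists>a. r = scalar_tuple a) \<and> (\<exists>a. s = scalar_tuple a) \<and>
          (\<exists>a. t = scalar_tuple a) \<and> ?f [u_elt t] = ?f [u_elt r] + ?f [u_elt s]"
        by (auto simp: f scalar_tuple_eq_iff)
      finally show ?thesis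
        using s t env[of "[r, s, t]"] by (simp add: FPlus D field_pair_simps del: field_graph_form.simps)
    next
      case FTimes
      then obtain r s where s: "r \<in> ucarrier k" "s \<in> ucarrier k" "xss = [[u_elt r], [u_elt s]]"
        using pair g by (simp add: field_pair_sig_simps) blast
      have "tuple_sat (list_env [r, s, t] params) (field_graph_form g) \<longleftrightarrow>
          (\<exists>a b. r = scalar_tuple a \<and> s = scalar_tuple b \<and> t = scalar_tuple (a * b))"
        unfolding FTimes by (subst tuple_sat_field_forms[OF T]) (use s t in \<open>simp_all add: list_env_def\<close>)
      also have "\<dots> \<longleftrightarrow> (\<exists>a. r = scalar_tuple a) \<and> (\<exists>a. s = scalar_tuple a) \<and>
          (\<exists>a. t = scalar_tuple a) \<and> ?f [u_elt t] = ?f [u_elt r] * ?f [u_elt s]"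
        by (auto simp: f scalar_tuple_eq_iff)
      finally show ?thesis
        using s t env[of "[r, s, t]"] by (simp add: FTimes D field_pair_simps del: field_graph_form.simps)
    qed
  next
    fix r m xss
    assume "rel_ar field_pair_sig r = Some m" "length xss = m"
      and l: "\<And>xs. xs \<in> set xss \<Longrightarrow> length xs = 1 \<and> set xs \<subseteq> univ ?M"
    then have "length xss = 1" by (simp add: field_pair_sig_simps)
    then obtain xs where xs: "xss = [xs]" by (auto simp: length_Suc_conv)
    obtain s where s: "s \<in> ucarrier k" "xs = [u_elt s]" using single l xs by (meson list.set_intros(1))
    have "tuple_sat (list_env [s] params) subfield_form \<longleftrightarrow> (\<exists>c\<in>k. s = scalar_tuple c)"
      by (subst tuple_sat_field_forms[OF T]) (use s in \<open>simp_all add: list_env_def\<close>)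
    also have "\<dots> \<longleftrightarrow> (\<exists>c. s = scalar_tuple c) \<and> ?f [u_elt s] \<in> k"
      by (auto simp: f scalar_tuple_eq_iff)
    finally show "sat ?M (list_env (concat xss) ?e) subfield_form \<longleftrightarrow>
        set xss \<subseteq> ?D \<and> rint (field_pair k) r (map ?f xss)"
      using s env[of "[s]"] by (simp add: xs D field_pair_simps)
  qed (simp_all add: field_graph_form_wf)
qed

end

theorem theorem6p3:
  fixes k :: "'a::field set"
  assumes "CHAR('a) = 3"
    and "is_subfield k"
    and "range (\<lambda>a::'a. a ^ 3) \<subseteq> k"
  shows "interpretable_in group_sig (group_structure (U_group k)) field_pair_sig (field_pair k) \<and>
         interpretable_in field_pair_sig (field_pair k) group_sig (group_structure (U_group k))"
proof -
  interpret subfield_cubes k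
    using assms three_eq_0 by unfold_locales auto
  show ?thesis using U_group_interpretable field_pair_interpretable by blast
qed

end
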